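(* Let $G_1=(V_1,E_1)$ and $G_2=(V_2,E_2)$ be simple connected graphs with $V_1\cap V_2=\emptyset$, let $x\in V_1$, $y\in V_2$, $e=\{x,y\}$, and let $G=(V_1\cup V_2,E_1\cup E_2\cup\{e\})$. Then $$\beta_1(\mathbb{K}[G])=\beta_1(\mathbb{K}[G/e]).$$
   Context: For a finite simple graph $H=(V,E)$, the toric ideal $I_H\subseteq\mathbb{K}[E]$ is the kernel of the $\mathbb{K}$-algebra map $\mathbb{K}[E]\to\mathbb{K}[V]$ sending an edge $\{u,v\}$ to $uv$; $\mathbb{K}[H]=\mathbb{K}[E]/I_H$ (standard graded), and $\beta_i(\mathbb{K}[H])$ denotes its $i$-th total Betti number over $\mathbb{K}[E]$ (so $\beta_1$ is the number of minimal generators of $I_H$). Contraction of an edge $e=\{x,y\}$ of $H$: with a new vertex $y_0$, $V'=(V\cup\{y_0\})\setminus\{x,y\}$, $\chi:V\to V'$ the identity on $V\setminus\{x,y\}$ sending $x,y$ to $y_0$, $E'=\{\{\chi(u),\chi(u')\}:\{u,u'\}\in E\setminus\{e\}\}$ (repetitions ignored), and $H/e=(V',E')$. *)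

theory Defs
  imports "HOL-Library.Poly_Mapping"
begin

text \<open>Finite simple graphs: a finite vertex set V and a set E of 2-element subsets of V.\<close>
definition simple_graph :: "'v set \<Rightarrow> 'v set set \<Rightarrow> bool" where
  "simple_graph V E \<longleftrightarrow> finite V \<and> (\<forall>f\<in>E. f \<subseteq> V \<and> card f = 2)"

definition adj :: "'v set set \<Rightarrow> ('v \<times> 'v) set" where
  "adj E = {(u, w). {u, w} \<in> E}"

definition connected_graph :: "'v set \<Rightarrow> 'v set set \<Rightarrow> bool" where
  "connected_graph V E \<longleftrightarrow> V \<noteq> {} \<and> (\<forall>u\<in>V. \<forall>w\<in>V. (u, w) \<in> (adj E)\<^sup>*)"

text \<open>Contraction of the edge {x,y}, the two endpoints being replaced by the new vertex y0.\<close>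
definition contr_map :: "'v \<Rightarrow> 'v \<Rightarrow> 'v \<Rightarrow> 'v \<Rightarrow> 'v" where
  "contr_map x y y0 u = (if u = x \<or> u = y then y0 else u)"

definition contract_V :: "'v set \<Rightarrow> 'v \<Rightarrow> 'v \<Rightarrow> 'v \<Rightarrow> 'v set" where
  "contract_V V x y y0 = insert y0 (V - {x, y})"

definition contract_E :: "'v set set \<Rightarrow> 'v \<Rightarrow> 'v \<Rightarrow> 'v \<Rightarrow> 'v set set" where
  "contract_E E x y y0 = {contr_map x y y0 ` f | f. f \<in> E - {{x, y}}}"

text \<open>Polynomials over a field 'k in variables indexed by edges (type 'v set);
  monomials are finitely supported exponent vectors.\<close>
type_synonym ('v, 'k) epoly = "('v set \<Rightarrow>\<^sub>0 nat) \<Rightarrow>\<^sub>0 'k"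
type_synonym ('v, 'k) vpoly = "('v \<Rightarrow>\<^sub>0 nat) \<Rightarrow>\<^sub>0 'k"

text \<open>Membership in the polynomial ring K[E].\<close>
definition in_ring :: "'v set set \<Rightarrow> ('v, 'k::field) epoly \<Rightarrow> bool" where
  "in_ring E p \<longleftrightarrow> (\<forall>m\<in>Poly_Mapping.keys p. Poly_Mapping.keys m \<subseteq> E)"

text \<open>Image of an edge monomial under  {u,w} \<mapsto> u w.\<close>
definition vmono :: "('v set \<Rightarrow>\<^sub>0 nat) \<Rightarrow> ('v \<Rightarrow>\<^sub>0 nat)" where
  "vmono m = (\<Sum>f\<in>Poly_Mapping.keys m. \<Sum>v\<in>f. Poly_Mapping.single v (Poly_Mapping.lookup m f))"

text \<open>The K-algebra map K[E] \<rightarrow> K[V].\<close>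
definition edge_map :: "('v, 'k::field) epoly \<Rightarrow> ('v, 'k) vpoly" where
  "edge_map p = (\<Sum>m\<in>Poly_Mapping.keys p. Poly_Mapping.single (vmono m) (Poly_Mapping.lookup p m))"

definition toric_ideal :: "'v set set \<Rightarrow> ('v, 'k::field) epoly set" where
  "toric_ideal E = {p. in_ring E p \<and> edge_map p = 0}"

text \<open>The ideal of K[E] generated by S.\<close>
definition ideal_span :: "'v set set \<Rightarrow> ('v, 'k::field) epoly set \<Rightarrow> ('v, 'k) epoly set" where
  "ideal_span E S = {(\<Sum>s\<in>F. c s * s) | F c. finite F \<and> F \<subseteq> S \<and> (\<forall>s\<in>F. in_ring E (c s))}"

text \<open>beta_1(K[H]) = number of minimal generators of the (homogeneous) ideal I_H,
  i.e. the least cardinality of a generating set of I_H.\<close>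
definition beta1 :: "'k::field itself \<Rightarrow> 'v set set \<Rightarrow> nat" where
  "beta1 _ E = (LEAST n. \<exists>S :: ('v, 'k) epoly set. finite S \<and> card S = n \<and>
       S \<subseteq> toric_ideal E \<and> ideal_span E S = toric_ideal E)"

end

theory Submission
  imports Defs "HOL-Library.Multiset" "HOL.Vector_Spaces"
begin

text \<open>
  By graded Nakayama, the least number of generators of a toric ideal is the least number of
  binomials, taken from any prescribed set of binomials that linearly spans the ideal, whose moves
  connect all monomials of equal degree.

  Write A, A' for monomials in the edges of the first graph and B, B' for monomials in the edges
  of the second one. The relations of the bridged graph are A e^n B = A' B', those of the
  contracted graph are A B' = A' B, in both cases with deg A' = deg A + n x and
  deg B' = deg B + n y. Exchanging edges along an alternating walk shows that A and A' are joined by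
  monomials whose degree at x grows in steps of 2, so that n = 0 and n = 2 suffice on both sides.
  With this restriction, a set of quadruples (A, A', B, B') gives generators of one ideal if and
  only if it gives generators of the other: both amount to generating the two toric ideals of the
  parts and to having, for each pair of jumps by 2, a quadruple that crosses it.
\<close>

section \<open>Edge multisets and the congruence of equal degree\<close>

text \<open>No graded isomorphism is behind the equality: a crossing relation
  \<open>A e^2 B = A' B'\<close> has degree |A| + |B| + 2, while its contracted counterpart
  \<open>A B' = A' B\<close> has degree |A| + |B| + 1, since raising the vertex degree by 2 costs
  one edge. The two ideals are therefore compared in cardinality only: generators of one ideal yield
  at most as many quadruples, and these yield at most as many generators of the other. Odd
  \<open>n\<close> cannot occur because the vertex degree of an edge monomial has even size. Along a
  path whose moves change the level at \<open>x\<close> by 0 or 2, no level of the right parity can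
  be skipped; hence a generating set made of such moves must contain, for each pair of adjacent
  levels, a move making exactly that step. Such a crossing is asked for only up to equal degree,
  because the generators of the toric ideals of the two parts adjust the rest.\<close>

definition vdeg :: "'v set multiset \<Rightarrow> 'v multiset" where
  "vdeg A = (\<Sum>f\<in>#A. mset_set f)"

definition fib :: "'v set set \<Rightarrow> ('v set multiset \<times> 'v set multiset) set" where
  "fib E = {(A, B). set_mset A \<subseteq> E \<and> set_mset B \<subseteq> E \<and> vdeg A = vdeg B}"

text \<open>The pairs in \<open>P\<close> stand for binomials, applicable in both directions and
  after multiplication by any monomial in \<open>E\<close>. For \<open>P \<subseteq> fib E\<close>,
  the inclusion \<open>fib E \<subseteq> gen E P\<close> says that \<open>P\<close> is a Markov
  basis.\<close>

definition move :: "'a set \<Rightarrow> ('a multiset \<times> 'a multiset) set \<Rightarrow> ('a multiset \<times> 'a multiset) set" where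
  "move E P = {(w + p, w + q) | w p q. set_mset w \<subseteq> E \<and> (p, q) \<in> P \<union> P\<inverse>}"

definition gen :: "'a set \<Rightarrow> ('a multiset \<times> 'a multiset) set \<Rightarrow> ('a multiset \<times> 'a multiset) set" where
  "gen E P = (move E P)\<^sup>*"

lemma vdeg_empty [simp]: "vdeg {#} = {#}"
  by (simp add: vdeg_def)

lemma vdeg_add [simp]: "vdeg (A + B) = vdeg A + vdeg B"
  by (simp add: vdeg_def)

lemma vdeg_add_mset [simp]: "vdeg (add_mset f A) = mset_set f + vdeg A"
  by (simp add: vdeg_def)

lemma size_vdeg: "(\<And>f. f \<in># A \<Longrightarrow> card f = 2) \<Longrightarrow> size (vdeg A) = 2 * size A"
  by (induction A) auto

lemma in_vdegD:
  assumes "v \<in># vdeg A" shows "\<exists>f. f \<in># A \<and> v \<in> f"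
  using assms
proof (induction A)
  case (add f A)
  then show ?case by (cases "finite f") auto
qed simp

lemma in_vdegI: "f \<in># A \<Longrightarrow> finite f \<Longrightarrow> v \<in> f \<Longrightarrow> v \<in># vdeg A"
  by (induction A) auto

text \<open>Homogeneity of the toric ideal, which later supports an induction on the degree.\<close>

lemma fib_size:
  assumes "(A, B) \<in> fib E" "\<forall>f\<in>E. card f = 2" shows "size A = size B"
proof -
  have "size (vdeg A) = 2 * size A" "size (vdeg B) = 2 * size B"
    using assms by (intro size_vdeg; auto simp: fib_def)+
  then show ?thesis using assms by (auto simp: fib_def)
qed

lemma fib_refl: "set_mset A \<subseteq> E \<Longrightarrow> (A, A) \<in> fib E"
  by (simp add: fib_def)

lemma fib_sym: "(A, B) \<in> fib E \<Longrightarrow> (B, A) \<in> fib E"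
  by (auto simp: fib_def)

lemma fib_trans: "(A, B) \<in> fib E \<Longrightarrow> (B, C) \<in> fib E \<Longrightarrow> (A, C) \<in> fib E"
  by (auto simp: fib_def)

lemma fib_add: "(A, B) \<in> fib E \<Longrightarrow> set_mset w \<subseteq> E \<Longrightarrow> (w + A, w + B) \<in> fib E"
  by (auto simp: fib_def)

lemma move_sym: "(A, B) \<in> move E P \<Longrightarrow> (B, A) \<in> move E P"
  unfolding move_def by blast

lemma gen_refl: "(A, A) \<in> gen E P"
  by (simp add: gen_def)

lemma gen_trans: "(A, B) \<in> gen E P \<Longrightarrow> (B, C) \<in> gen E P \<Longrightarrow> (A, C) \<in> gen E P"
  unfolding gen_def by (rule rtrancl_trans)

lemma gen_sym: "(A, B) \<in> gen E P \<Longrightarrow> (B, A) \<in> gen E P"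
  unfolding gen_def
  by (rule symD[OF sym_rtrancl]) (auto intro: symI move_sym)

lemma gen_base: "(A, B) \<in> P \<Longrightarrow> set_mset w \<subseteq> E \<Longrightarrow> (w + A, w + B) \<in> gen E P"
  unfolding gen_def move_def by blast

lemma gen_add:
  assumes "(A, B) \<in> gen E P" "set_mset w \<subseteq> E" shows "(w + A, w + B) \<in> gen E P"
  using assms(1) unfolding gen_def
proof (induction rule: rtrancl_induct)
  case (step B C)
  obtain u p q where "B = u + p" "C = u + q" "set_mset u \<subseteq> E" "(p, q) \<in> P \<union> P\<inverse>"
    using step(2) unfolding move_def by auto
  then have "(w + B, w + C) \<in> move E P"
    unfolding move_def using assms(2)
    by (intro CollectI exI[of _ "w + u"] exI[of _ p] exI[of _ q]) (auto simp: add.assoc)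
  with step(3) show ?case by (rule rtrancl_into_rtrancl)
qed simp

lemma gen_add2:
  assumes "(A, A') \<in> gen E P" "(B, B') \<in> gen E P" "set_mset B \<subseteq> E" "set_mset A' \<subseteq> E"
  shows "(A + B, A' + B') \<in> gen E P"
proof -
  have "(A + B, A' + B) \<in> gen E P" using gen_add[OF assms(1,3)] by (simp add: add.commute)
  then show ?thesis using gen_add[OF assms(2,4)] by (rule gen_trans)
qed

lemma move_fib: "P \<subseteq> fib E \<Longrightarrow> (A, B) \<in> move E P \<Longrightarrow> (A, B) \<in> fib E"
  unfolding move_def fib_def by auto blast+

lemma gen_fib:
  assumes "P \<subseteq> fib E" "set_mset A \<subseteq> E" "(A, B) \<in> gen E P" shows "(A, B) \<in> fib E"
  using assms(3) unfolding gen_def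
proof (induction rule: rtrancl_induct)
  case base show ?case using assms(2) by (rule fib_refl)
next
  case (step B C) then show ?case using move_fib[OF assms(1)] fib_trans by blast
qed

lemma equiv_closure_subset_gen:
  assumes "Q \<subseteq> gen E P" shows "(Q \<union> Q\<inverse>)\<^sup>* \<subseteq> gen E P"
proof -
  have "Q \<union> Q\<inverse> \<subseteq> gen E P" using assms gen_sym by blast
  then show ?thesis unfolding gen_def by (metis rtrancl_idemp rtrancl_mono)
qed

section \<open>Binomials and the toric ideal\<close>

text \<open>Exponent vectors are handled as multisets of edges.\<close>

definition pm :: "'a multiset \<Rightarrow> 'a \<Rightarrow>\<^sub>0 nat" where
  "pm A = (\<Sum>f\<in>#A. Poly_Mapping.single f 1)"

lemma pm_empty [simp]: "pm {#} = 0"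
  by (simp add: pm_def)

lemma pm_add [simp]: "pm (A + B) = pm A + pm B"
  by (simp add: pm_def)

lemma pm_add_mset: "pm (add_mset f A) = Poly_Mapping.single f 1 + pm A"
  by (simp add: pm_def)

lemma lookup_pm [simp]: "Poly_Mapping.lookup (pm A) f = count A f"
  by (induction A) (auto simp: pm_add_mset lookup_add lookup_single when_def)

lemma pm_inject [simp]: "pm A = pm B \<longleftrightarrow> A = B"
  by (metis lookup_pm multiset_eqI)

lemma keys_pm [simp]: "Poly_Mapping.keys (pm A) = set_mset A"
  by (auto simp: in_keys_iff)

lemma pm_surj: "\<exists>A. m = pm A"
proof -
  have "count (Abs_multiset (Poly_Mapping.lookup m)) = Poly_Mapping.lookup m"
    by (rule Abs_multiset_inverse) (use finite_lookup[of m] in simp)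
  then have "m = pm (Abs_multiset (Poly_Mapping.lookup m))"
    by (intro poly_mapping_eqI) simp
  then show ?thesis by blast
qed

lemma vmono_superset:
  assumes "finite F" "Poly_Mapping.keys m \<subseteq> F"
  shows "vmono m = (\<Sum>f\<in>F. \<Sum>v\<in>f. Poly_Mapping.single v (Poly_Mapping.lookup m f))"
  unfolding vmono_def by (rule sum.mono_neutral_left) (use assms in \<open>auto simp: in_keys_iff\<close>)

lemma vmono_add: "vmono (m + m') = vmono m + vmono m'"
proof -
  define F where "F = Poly_Mapping.keys m \<union> Poly_Mapping.keys m'"
  have F: "finite F" "Poly_Mapping.keys m \<subseteq> F" "Poly_Mapping.keys m' \<subseteq> F"
    "Poly_Mapping.keys (m + m') \<subseteq> F"
    using keys_add[of m m'] by (auto simp: F_def)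
  show ?thesis
    by (simp add: F vmono_superset[of F] lookup_add single_add sum.distrib)
qed

lemma vmono_single: "vmono (Poly_Mapping.single f 1) = pm (mset_set f)"
proof (cases "finite f")
  case True
  then have "(\<Sum>v\<in>f. Poly_Mapping.single v 1) = pm (mset_set f)"
    by induction (auto simp: pm_add_mset)
  then show ?thesis by (simp add: vmono_def)
\<comment> \<open>For infinite \<open>f\<close> both sides are 0, by the default values of
  \<open>sum\<close> and \<open>mset_set\<close>.\<close>
qed (simp add: vmono_def)

lemma vmono_pm: "vmono (pm A) = pm (vdeg A)"
  by (induction A) (simp_all add: pm_add_mset vmono_add vmono_single[unfolded One_nat_def], simp add: vmono_def)

definition scl :: "'k::field \<Rightarrow> ('m::comm_monoid_add \<Rightarrow>\<^sub>0 'k) \<Rightarrow> 'm \<Rightarrow>\<^sub>0 'k" where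
  "scl c p = Poly_Mapping.single 0 c * p"

interpretation pv: vector_space "scl :: 'k::field \<Rightarrow> ('m::comm_monoid_add \<Rightarrow>\<^sub>0 'k) \<Rightarrow> 'm \<Rightarrow>\<^sub>0 'k"
  by unfold_locales
    (simp_all add: scl_def distrib_left single_add distrib_right mult_single mult.assoc[symmetric])

lemma lookup_scl [simp]: "Poly_Mapping.lookup (scl c p) m = c * Poly_Mapping.lookup p m"
  unfolding scl_def mult_map_scale_conv_mult[symmetric]
  by (simp add: Poly_Mapping.map.rep_eq when_def)

lemma scl_single: "scl c (Poly_Mapping.single m d) = Poly_Mapping.single m (c * d)"
  by (simp add: scl_def mult_single)

lemma mult_scl: "p * scl c q = scl c (p * q)"
  by (simp add: scl_def mult.left_commute)

lemma scl_mult: "scl c p * q = scl c (p * q)"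
  by (simp add: scl_def mult.assoc)

lemma poly_eq_sum_single:
  "p = (\<Sum>m\<in>Poly_Mapping.keys p. Poly_Mapping.single m (Poly_Mapping.lookup p m))"
  by (rule poly_mapping_eqI)
    (auto simp: lookup_sum lookup_single when_def in_keys_iff sum.delta'
      cong: if_cong intro!: sum.neutral)

text \<open>A linear functional for each set \<open>Z\<close> of monomials. With \<open>Z\<close> a
  fibre of \<open>vmono\<close> it is a coefficient of the image under \<open>edge_map\<close>; with
  \<open>Z\<close> a class of \<open>gen\<close> it separates the span of a set of binomials from
  binomials that leave the class.\<close>

definition csum :: "'m set \<Rightarrow> ('m \<Rightarrow>\<^sub>0 'k::field) \<Rightarrow> 'k" where
  "csum Z f = (\<Sum>m\<in>Poly_Mapping.keys f \<inter> Z. Poly_Mapping.lookup f m)"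

lemma csum_superset:
  assumes "finite F" "Poly_Mapping.keys f \<subseteq> F"
  shows "csum Z f = (\<Sum>m\<in>F \<inter> Z. Poly_Mapping.lookup f m)"
  unfolding csum_def by (rule sum.mono_neutral_left) (use assms in \<open>auto simp: in_keys_iff\<close>)

lemma csum_zero [simp]: "csum Z 0 = 0"
  by (simp add: csum_def)

lemma csum_add: "csum Z (f + g) = csum Z f + csum Z g"
proof -
  define F where "F = Poly_Mapping.keys f \<union> Poly_Mapping.keys g"
  have F: "finite F" "Poly_Mapping.keys f \<subseteq> F" "Poly_Mapping.keys g \<subseteq> F"
    "Poly_Mapping.keys (f + g) \<subseteq> F"
    using keys_add[of f g] by (auto simp: F_def)
  show ?thesis by (simp add: F csum_superset[of F] lookup_add sum.distrib)
qed

lemma keys_scl: "Poly_Mapping.keys (scl c f) \<subseteq> Poly_Mapping.keys f"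
  by (auto simp: in_keys_iff)

lemma csum_scl: "csum Z (scl c f) = c * csum Z f"
  by (simp add: csum_superset[OF _ keys_scl[of c f]] csum_def[of Z f] sum_distrib_left)

lemma csum_single: "csum Z (Poly_Mapping.single m c) = (if m \<in> Z then c else 0)"
  by (simp add: csum_superset[of "{m}"])

lemma csum_diff: "csum Z (f - g) = csum Z f - csum Z g"
  using csum_add[of Z "f - g" g] by simp

lemma subspace_csum: "pv.subspace {f. csum Z f = 0}"
  by (rule pv.subspaceI) (auto simp: csum_add csum_scl)

lemma lookup_edge_map: "Poly_Mapping.lookup (edge_map f) d = csum {m. vmono m = d} f"
proof -
  have "Poly_Mapping.lookup (edge_map f) d
      = (\<Sum>m\<in>Poly_Mapping.keys f. if vmono m = d then Poly_Mapping.lookup f m else 0)"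
    by (simp add: edge_map_def lookup_sum lookup_single when_def)
  also have "\<dots> = csum {m. vmono m = d} f"
    by (simp add: csum_def sum.inter_restrict)
  finally show ?thesis .
qed

lemma edge_map_eq_0_iff: "edge_map f = 0 \<longleftrightarrow> (\<forall>d. csum {m. vmono m = d} f = 0)"
  by (auto simp: poly_mapping_eq_iff fun_eq_iff lookup_edge_map)

section \<open>Binomials and their linear span\<close>

definition xm :: "'v set multiset \<Rightarrow> ('v, 'k::field) epoly" where
  "xm A = Poly_Mapping.single (pm A) 1"

definition bin :: "'v set multiset \<times> 'v set multiset \<Rightarrow> ('v, 'k::field) epoly" where
  "bin p = xm (fst p) - xm (snd p)"

lemma xm_mult: "xm A * xm B = xm (A + B)"
  by (simp add: xm_def mult_single)

lemma xm_mult_bin: "xm w * bin (A, B) = bin (w + A, w + B)"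
  by (simp add: bin_def right_diff_distrib xm_mult)

lemma csum_bin: "csum Z (bin (A, B)) = (if pm A \<in> Z then 1 else 0) - (if pm B \<in> Z then 1 else 0)"
  by (simp add: bin_def csum_diff xm_def csum_single)

lemma in_ring_xm: "set_mset A \<subseteq> E \<Longrightarrow> in_ring E (xm A)"
  by (auto simp: in_ring_def xm_def)

lemma in_ring_0: "in_ring E 0"
  by (simp add: in_ring_def)

lemma in_ring_add: "in_ring E f \<Longrightarrow> in_ring E g \<Longrightarrow> in_ring E (f + g)"
  using keys_add[of f g] by (auto simp: in_ring_def)

lemma in_ring_diff: "in_ring E f \<Longrightarrow> in_ring E g \<Longrightarrow> in_ring E (f - g)"
  using keys_diff[of f g] by (fastforce simp: in_ring_def)

lemma in_ring_scl: "in_ring E f \<Longrightarrow> in_ring E (scl c f)"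
  using keys_scl[of c f] by (auto simp: in_ring_def)

lemma subspace_toric_ideal: "pv.subspace (toric_ideal E)"
  by (rule pv.subspaceI)
    (auto simp: toric_ideal_def in_ring_0 in_ring_add in_ring_scl edge_map_eq_0_iff csum_add csum_scl)

lemma bin_in_toric_ideal: "p \<in> fib E \<Longrightarrow> bin p \<in> toric_ideal E"
  by (cases p) (auto simp: fib_def toric_ideal_def in_ring_diff in_ring_xm edge_map_eq_0_iff csum_bin vmono_pm,
      simp add: bin_def in_ring_diff in_ring_xm)

text \<open>In an element of the kernel the coefficients over each fibre of \<open>vmono\<close> sum
  to 0. Replacing every monomial by one representative of its fibre therefore gives 0, and
  subtracting this from the element writes it in binomials.\<close>

lemma toric_ideal_eq_span:
  "toric_ideal E = pv.span ((bin :: _ \<Rightarrow> ('v, 'k::field) epoly) ` fib E)"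
proof
  show "pv.span ((bin :: _ \<Rightarrow> ('v, 'k) epoly) ` fib E) \<subseteq> toric_ideal E"
    by (rule pv.span_minimal[OF _ subspace_toric_ideal]) (auto intro: bin_in_toric_ideal)
  show "toric_ideal E \<subseteq> pv.span ((bin :: _ \<Rightarrow> ('v, 'k) epoly) ` fib E)"
  proof
    fix f :: "('v, 'k) epoly" assume f: "f \<in> toric_ideal E"
    define K where "K = Poly_Mapping.keys f"
    have finK: "finite K" by (simp add: K_def)
    define c where "c = Poly_Mapping.lookup f"
    \<comment> \<open>The choice depends on \<open>vmono m\<close> only, so \<open>r\<close> is
      constant on each fibre.\<close>
    define r where "r m = (SOME m'. m' \<in> K \<and> vmono m' = vmono m)" for m
    have r: "r m \<in> K \<and> vmono (r m) = vmono m" if "m \<in> K" for m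
      unfolding r_def by (rule someI[of _ m]) (use that in simp)
    have rcong: "r m = r m'" if "vmono m = vmono m'" for m m'
      by (simp add: r_def that)
    have "(\<Sum>m\<in>K. Poly_Mapping.single (r m) (c m))
        = (\<Sum>d\<in>vmono ` K. \<Sum>m\<in>{m \<in> K. vmono m = d}. Poly_Mapping.single (r m) (c m))"
      by (rule sum.image_gen[OF finK])
    also have "\<dots> = 0"
    proof (rule sum.neutral, rule ballI)
      fix d assume "d \<in> vmono ` K"
      then obtain m0 where m0: "m0 \<in> K" "d = vmono m0" by blast
      have "(\<Sum>m\<in>{m \<in> K. vmono m = d}. Poly_Mapping.single (r m) (c m))
          = (\<Sum>m\<in>{m \<in> K. vmono m = d}. Poly_Mapping.single (r m0) (c m))"
        by (intro sum.cong refl arg_cong2[where f = Poly_Mapping.single] rcong) (use m0(2) in simp)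
      also have "\<dots> = Poly_Mapping.single (r m0) (\<Sum>m\<in>{m \<in> K. vmono m = d}. c m)"
        by (induction rule: infinite_finite_induct) (auto simp: single_add)
      also have "(\<Sum>m\<in>{m \<in> K. vmono m = d}. c m) = csum {m. vmono m = d} f"
        by (simp add: csum_def K_def c_def Int_def)
      also have "\<dots> = 0" using f by (auto simp: toric_ideal_def edge_map_eq_0_iff)
      finally show "(\<Sum>m\<in>{m \<in> K. vmono m = d}. Poly_Mapping.single (r m) (c m)) = 0" by simp
    qed
    finally have z: "(\<Sum>m\<in>K. Poly_Mapping.single (r m) (c m)) = 0" .
    have "f = (\<Sum>m\<in>K. Poly_Mapping.single m (c m)) - (\<Sum>m\<in>K. Poly_Mapping.single (r m) (c m))"
      using poly_eq_sum_single[of f] z by (simp add: K_def c_def)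
    also have "\<dots> = (\<Sum>m\<in>K. scl (c m) (Poly_Mapping.single m 1 - Poly_Mapping.single (r m) 1))"
      by (simp add: pv.scale_right_diff_distrib scl_single sum_subtractf)
    also have "\<dots> \<in> pv.span (bin ` fib E)"
    proof (intro pv.span_sum pv.span_scale)
      fix m assume m: "m \<in> K"
      obtain A B where AB: "m = pm A" "r m = pm B" using pm_surj by metis
      have "in_ring E f" using f by (simp add: toric_ideal_def)
      then have "Poly_Mapping.keys m \<subseteq> E" "Poly_Mapping.keys (r m) \<subseteq> E"
        using m r[OF m] unfolding in_ring_def K_def by blast+
      moreover have "vdeg A = vdeg B"
        using r[OF m] AB by (metis pm_inject vmono_pm)
      ultimately have "(A, B) \<in> fib E" unfolding AB(2) by (simp add: fib_def AB(1))
      moreover have "Poly_Mapping.single m 1 - Poly_Mapping.single (r m) 1 = (bin (A, B) :: ('v, 'k) epoly)"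
        unfolding AB(2) by (simp add: AB(1) bin_def xm_def)
      ultimately show "Poly_Mapping.single m 1 - Poly_Mapping.single (r m) (1::'k) \<in> pv.span (bin ` fib E)"
        by (auto intro: pv.span_base)
    qed
    finally show "f \<in> pv.span (bin ` fib E)" .
  qed
qed

text \<open>The binomials along a path telescope; a backward step contributes with a minus
  sign.\<close>

lemma bin_equiv_closure:
  assumes "(A, B) \<in> (Q \<union> Q\<inverse>)\<^sup>*"
  shows "(bin (A, B) :: ('v, 'k::field) epoly) \<in> pv.span (bin ` Q)"
  using assms
proof (induction rule: rtrancl_induct)
  case base show ?case by (simp add: bin_def pv.span_zero)
next
  case (step B C)
  have "(bin (B, C) :: ('v, 'k) epoly) \<in> pv.span (bin ` Q)"
  proof (cases "(B, C) \<in> Q")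
    case True then show ?thesis by (intro pv.span_base) auto
  next
    case False
    then have "- (bin (C, B) :: ('v, 'k) epoly) \<in> pv.span (bin ` Q)"
      using step(2) by (intro pv.span_neg pv.span_base) auto
    then show ?thesis by (simp add: bin_def)
  qed
  then have "(bin (A, B) + bin (B, C) :: ('v, 'k) epoly) \<in> pv.span (bin ` Q)"
    using step(3) by (intro pv.span_add)
  then show ?case by (simp add: bin_def)
qed

text \<open>Coefficients are split into monomials \<open>w\<close>. The constant one leaves a
  generator in the span of \<open>S\<close>; any other one multiplies binomials into the second set,
  which spans the product of the toric ideal with the maximal ideal.\<close>

lemma ideal_span_subset:
  fixes S :: "('v, 'k::field) epoly set"
  assumes "S \<subseteq> toric_ideal E"
  shows "ideal_span E S \<subseteq> pv.span (S \<union> {bin (w + A, w + B) | w A B. w \<noteq> {#} \<and> set_mset w \<subseteq> E \<and> (A, B) \<in> fib E})"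
    (is "_ \<subseteq> pv.span (S \<union> ?W)")
proof
  fix f assume "f \<in> ideal_span E S"
  then obtain F c where F: "finite F" "F \<subseteq> S" "\<forall>s\<in>F. in_ring E (c s)" and f: "f = (\<Sum>s\<in>F. c s * s)"
    unfolding ideal_span_def by blast
  have "c s * s \<in> pv.span (S \<union> ?W)" if s: "s \<in> F" for s
  proof -
    have "c s * s = (\<Sum>m\<in>Poly_Mapping.keys (c s). Poly_Mapping.single m (Poly_Mapping.lookup (c s) m)) * s"
      using poly_eq_sum_single[of "c s"] by simp
    also have "\<dots> = (\<Sum>m\<in>Poly_Mapping.keys (c s). scl (Poly_Mapping.lookup (c s) m) (Poly_Mapping.single m 1 * s))"
      by (simp add: sum_distrib_right scl_mult[symmetric] scl_single)
    also have "\<dots> \<in> pv.span (S \<union> ?W)"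
    proof (intro pv.span_sum pv.span_scale)
      fix m assume m: "m \<in> Poly_Mapping.keys (c s)"
      obtain w where w: "m = pm w" using pm_surj by blast
      have wE: "set_mset w \<subseteq> E" using m s F(3) keys_pm[of w] unfolding in_ring_def w by blast
      show "Poly_Mapping.single m 1 * s \<in> pv.span (S \<union> ?W)"
      proof (cases "w = {#}")
        case True
        then show ?thesis using s F(2) by (auto simp: w intro: pv.span_base)
      next
        case False
        have "s \<in> pv.span (bin ` fib E)" using s F(2) assms toric_ideal_eq_span by blast
        then have "xm w * s \<in> pv.span ?W"
        proof (induction rule: pv.span_induct_alt)
          case (step a p q)
          obtain A B where "p = bin (A, B)" "(A, B) \<in> fib E" using step(1) by auto
          then have "xm w * p \<in> ?W" using wE False by (auto simp: xm_mult_bin)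
          then show ?case using step(2)
            by (simp add: distrib_left mult_scl pv.span_add pv.span_scale pv.span_base)
        qed (simp add: pv.span_zero)
        moreover have "pv.span ?W \<subseteq> pv.span (S \<union> ?W)" by (rule pv.span_mono) simp
        ultimately show ?thesis by (auto simp: xm_def w)
      qed
    qed
    finally show ?thesis .
  qed
  then show "f \<in> pv.span (S \<union> ?W)" unfolding f by (rule pv.span_sum)
qed

text \<open>Steinitz exchange in the quotient by the span of \<open>W\<close>, without forming the
  quotient: a basis \<open>W0\<close> of that span is extended by elements of \<open>Q\<close>, and
  the added elements form \<open>Q0\<close>.\<close>

lemma (in vector_space) exchange_modulo:
  assumes "finite S" "Q \<subseteq> span (S \<union> W)"
  obtains Q0 where "Q0 \<subseteq> Q" "finite Q0" "card Q0 \<le> card S" "Q \<subseteq> span (Q0 \<union> W)"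
proof -
  obtain W0 where W0: "W0 \<subseteq> W" "independent W0" "W \<subseteq> span W0"
    by (rule maximal_independent_subset_extend[of "{}" W]) (auto simp: independent_empty)
  obtain B where B: "W0 \<subseteq> B" "B \<subseteq> W0 \<union> Q" "independent B" "W0 \<union> Q \<subseteq> span B"
    by (rule maximal_independent_subset_extend[of W0 "W0 \<union> Q"]) (use W0(2) in auto)
  have span: "span (S \<union> W) \<subseteq> span (S \<union> W0)"
    using W0(3) span_mono[of W0 "S \<union> W0"] span_superset[of "S \<union> W0"]
    by (intro span_minimal) auto
  have bound: "card C \<le> card S" if C: "finite C" "C \<subseteq> B - W0" for C
  proof -
    have "\<exists>T. finite T \<and> T \<subseteq> S \<union> W0 \<and> c \<in> span T" if "c \<in> C" for c
    proof -
      have "c \<in> span (S \<union> W0)" using that C B(2) assms(2) span by blast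
      then obtain t r where t: "finite t" "t \<subseteq> S \<union> W0" "c = (\<Sum>a\<in>t. scale (r a) a)"
        unfolding span_explicit by blast
      have "c \<in> span t" unfolding t(3) by (intro span_sum span_scale span_base)
      with t show ?thesis by blast
    qed
    then obtain T where T: "\<And>c. c \<in> C \<Longrightarrow> finite (T c) \<and> T c \<subseteq> S \<union> W0 \<and> c \<in> span (T c)"
      by metis
    \<comment> \<open>\<open>W0\<close> may be infinite. Only the finitely many of its elements that
      express \<open>C\<close> are kept; they occur on both sides of the dimension bound and
      cancel.\<close>
    define W1 where "W1 = (\<Union>c\<in>C. T c) \<inter> W0"
    have W1: "finite W1" "W1 \<subseteq> W0" using T C(1) by (auto simp: W1_def)
    have "C \<union> W1 \<subseteq> span (S \<union> W1)"
    proof -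
      have "c \<in> span (S \<union> W1)" if "c \<in> C" for c
        using T[OF that] that span_mono[of "T c" "S \<union> W1"] by (auto simp: W1_def)
      then show ?thesis using span_superset[of "S \<union> W1"] by auto
    qed
    moreover have "independent (C \<union> W1)"
      by (rule independent_mono[OF B(3)]) (use C W1 B(1) in auto)
    ultimately have "card (C \<union> W1) \<le> card (S \<union> W1)"
      using independent_span_bound[of "S \<union> W1" "C \<union> W1"] assms(1) W1(1) by auto
    moreover have "card (C \<union> W1) = card C + card W1"
      using C W1 by (intro card_Un_disjoint) auto
    ultimately show ?thesis using card_Un_le[of S W1] by linarith
  qed
  \<comment> \<open>The bound holds for all finite subsets, so an infinite set would violate
    it.\<close>
  have fin: "finite (B - W0)"
  proof (rule ccontr)
    assume "infinite (B - W0)"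
    then obtain C where "C \<subseteq> B - W0" "finite C" "card C = Suc (card S)"
      using infinite_arbitrarily_large by blast
    then show False using bound[of C] by simp
  qed
  show thesis
  proof (rule that[of "B - W0"])
    have "B \<subseteq> (B - W0) \<union> W" using W0(1) by blast
    then show "Q \<subseteq> span (B - W0 \<union> W)" using B(4) span_mono by blast
  qed (use B fin bound[OF fin] in auto)
qed

text \<open>A Nakayama argument: the chosen binomials span the toric ideal modulo its product with the
  maximal ideal. Summing coefficients over the class of a monomial u is a linear functional that
  vanishes on them and, by induction on the degree, on that product.\<close>

lemma toric_generators_imp_gen:
  fixes S :: "('v, 'k::field) epoly set"
  assumes E: "\<forall>f\<in>E. card f = 2"
    and S: "finite S" "S \<subseteq> toric_ideal E" "ideal_span E S = toric_ideal E"
    and Q: "Q \<subseteq> fib E" "fib E \<subseteq> (Q \<union> Q\<inverse>)\<^sup>*"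
  obtains P where "P \<subseteq> Q" "finite P" "card P \<le> card S" "fib E \<subseteq> gen E P"
proof -
  define W :: "('v, 'k) epoly set"
    where "W = {bin (w + A, w + B) | w A B. w \<noteq> {#} \<and> set_mset w \<subseteq> E \<and> (A, B) \<in> fib E}"
  have "bin ` Q \<subseteq> toric_ideal E" using Q(1) bin_in_toric_ideal by blast
  then have "bin ` Q \<subseteq> pv.span (S \<union> W)"
    using ideal_span_subset[OF S(2)] S(3) unfolding W_def by auto
  then obtain Q0 where Q0: "Q0 \<subseteq> bin ` Q" "finite Q0" "card Q0 \<le> card S"
      "bin ` Q \<subseteq> pv.span (Q0 \<union> W)"
    using pv.exchange_modulo[OF S(1)] by metis
  \<comment> \<open>One pair is kept for each binomial, so that \<open>P\<close> is no larger than
    \<open>Q0\<close>.\<close>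
  obtain P where P: "P \<subseteq> Q" "finite P" "inj_on (bin :: _ \<Rightarrow> ('v, 'k) epoly) P" "Q0 = bin ` P"
    using Q0(1,2) subset_image_inj[of Q0 bin Q] finite_image_iff by metis
  have all: "bin (A, B) \<in> pv.span (bin ` P \<union> W)" if "(A, B) \<in> fib E" for A B
  proof -
    have "bin (A, B) \<in> pv.span (bin ` Q)" using bin_equiv_closure that Q(2) by blast
    also have "\<dots> \<subseteq> pv.span (bin ` P \<union> W)"
      using Q0(4) by (intro pv.span_minimal) (auto simp: P(4))
    finally show ?thesis .
  qed
  have Pf: "P \<subseteq> fib E" using P(1) Q(1) by blast
  have "(u, v) \<in> gen E P" if "(u, v) \<in> fib E" for u v
    using that
  proof (induction "size u" arbitrary: u v rule: less_induct)
    case less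
    define Z where "Z = pm ` {m. (u, m) \<in> gen E P}"
    have Z: "pm m \<in> Z \<longleftrightarrow> (u, m) \<in> gen E P" for m by (auto simp: Z_def)
    have uE: "set_mset u \<subseteq> E" using less.prems by (auto simp: fib_def)
    \<comment> \<open>The factor \<open>w\<close> is not 1, so \<open>A\<close> has smaller size
      than \<open>u\<close> and the induction hypothesis connects \<open>A\<close> to
      \<open>B\<close>.\<close>
    have one: "(u, w + B) \<in> gen E P" if "w \<noteq> {#}" "set_mset w \<subseteq> E" "(A, B) \<in> fib E" "(u, w + A) \<in> gen E P" for w A B
    proof -
      have "size u = size (w + A)" using fib_size[OF gen_fib[OF Pf uE that(4)] E] .
      then have "size A < size u" using that(1) by (simp add: nonempty_has_size)
      then have "(A, B) \<in> gen E P" using less.hyps that(3) by blast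
      then show ?thesis using gen_add that(2,4) gen_trans by metis
    qed
    have "bin ` P \<union> W \<subseteq> {f. csum Z f = 0}"
    proof -
      have "csum Z (bin (p, q) :: ('v, 'k) epoly) = 0" if "(p, q) \<in> P" for p q
        using gen_base[OF that, of "{#}"] gen_trans[of u p E P q] gen_trans[of u q E P p] gen_sym[of p q E P]
        by (auto simp: csum_bin Z)
      moreover have "csum Z f = 0" if "f \<in> W" for f
      proof -
        obtain w A B where f: "f = bin (w + A, w + B)" and w: "w \<noteq> {#}" "set_mset w \<subseteq> E" "(A, B) \<in> fib E"
          using \<open>f \<in> W\<close> unfolding W_def by blast
        have "(u, w + A) \<in> gen E P \<longleftrightarrow> (u, w + B) \<in> gen E P"
          using one[OF w] one[OF w(1,2) fib_sym[OF w(3)]] by blast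
        then show ?thesis by (simp only: f csum_bin Z) simp
      qed
      ultimately show ?thesis by auto
    qed
    then have "pv.span (bin ` P \<union> W) \<subseteq> {f. csum Z f = 0}"
      by (rule pv.span_minimal[OF _ subspace_csum])
    \<comment> \<open>Since \<open>u\<close> lies in its own class, the value is 1 unless
      \<open>v\<close> lies there too.\<close>
    then have "csum Z (bin (u, v) :: ('v, 'k) epoly) = 0" using all[OF less.prems] by blast
    then show ?case by (auto simp: csum_bin Z gen_refl split: if_splits)
  qed
  then have "fib E \<subseteq> gen E P" by auto
  moreover have "card P \<le> card S" using Q0(3) card_image[OF P(3)] P(4) by simp
  ultimately show thesis using that[of P] P(1,2) by blast
qed

text \<open>Every binomial of the toric ideal telescopes along a path of moves, and each move is a
  monomial multiple of a binomial from \<open>P\<close>.\<close>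

lemma gen_imp_toric_generators:
  fixes P :: "('v set multiset \<times> 'v set multiset) set"
  assumes P: "P \<subseteq> fib E" "finite P" "fib E \<subseteq> gen E P"
  obtains S :: "('v, 'k::field) epoly set" where
    "finite S" "card S \<le> card P" "S \<subseteq> toric_ideal E" "ideal_span E S = toric_ideal E"
proof -
  define S :: "('v, 'k) epoly set" where "S = bin ` P"
  have fin: "finite S" using P(2) by (simp add: S_def)
  have ST: "S \<subseteq> toric_ideal E" using P(1) bin_in_toric_ideal by (auto simp: S_def)
  have "ideal_span E S \<subseteq> toric_ideal E"
  proof -
    have "{bin (w + A, w + B) | w A B. w \<noteq> {#} \<and> set_mset w \<subseteq> E \<and> (A, B) \<in> fib E} \<subseteq> (toric_ideal E :: ('v, 'k) epoly set)"
      by (auto intro!: bin_in_toric_ideal fib_add)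
    then show ?thesis
      using ideal_span_subset[OF ST] pv.span_minimal[OF _ subspace_toric_ideal] ST
      by (meson Un_least order_trans)
  qed
  moreover have "toric_ideal E \<subseteq> ideal_span E S"
  proof -
    \<comment> \<open>With \<open>S\<close> finite, coefficients can be extended by 0 to all of
      \<open>S\<close>; linear operations then act on them pointwise.\<close>
    have full: "f \<in> ideal_span E S \<longleftrightarrow> (\<exists>c. (\<forall>s\<in>S. in_ring E (c s)) \<and> f = (\<Sum>s\<in>S. c s * s))" for f
    proof
      assume "f \<in> ideal_span E S"
      then obtain F c where F: "finite F" "F \<subseteq> S" "\<forall>s\<in>F. in_ring E (c s)" "f = (\<Sum>s\<in>F. c s * s)"
        unfolding ideal_span_def by blast
      have "(\<Sum>s\<in>F. c s * s) = (\<Sum>s\<in>S. (if s \<in> F then c s else 0) * s)"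
        by (rule sum.mono_neutral_cong_left) (use F fin in auto)
      then show "\<exists>c. (\<forall>s\<in>S. in_ring E (c s)) \<and> f = (\<Sum>s\<in>S. c s * s)"
        using F by (intro exI[of _ "\<lambda>s. if s \<in> F then c s else 0"]) (auto simp: in_ring_0)
    qed (use fin in \<open>auto simp: ideal_span_def\<close>)
    have sub: "pv.subspace (ideal_span E S)"
    proof (rule pv.subspaceI)
      show "0 \<in> ideal_span E S" unfolding full by (rule exI[of _ "\<lambda>_. 0"]) (simp add: in_ring_0)
    next
      fix f g assume "f \<in> ideal_span E S" "g \<in> ideal_span E S"
      then obtain c d where "\<forall>s\<in>S. in_ring E (c s)" "f = (\<Sum>s\<in>S. c s * s)"
        "\<forall>s\<in>S. in_ring E (d s)" "g = (\<Sum>s\<in>S. d s * s)" unfolding full by blast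
      then show "f + g \<in> ideal_span E S" unfolding full
        by (intro exI[of _ "\<lambda>s. c s + d s"]) (simp add: in_ring_add distrib_right sum.distrib)
    next
      fix a f assume "f \<in> ideal_span E S"
      then obtain c where "\<forall>s\<in>S. in_ring E (c s)" "f = (\<Sum>s\<in>S. c s * s)" unfolding full by blast
      then show "scl a f \<in> ideal_span E S" unfolding full
        by (intro exI[of _ "\<lambda>s. scl a (c s)"]) (simp add: in_ring_scl scl_mult pv.scale_sum_right)
    qed
    have base: "bin (w + p, w + q) \<in> ideal_span E S" if "(p, q) \<in> P" "set_mset w \<subseteq> E" for w p q
    proof -
      have "bin (w + p, w + q) = (\<Sum>s\<in>{bin (p, q)}. xm w * (s :: ('v, 'k) epoly))"
        by (simp add: xm_mult_bin)
      then show ?thesis unfolding ideal_span_def using that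
        by (intro CollectI exI[of _ "{bin (p, q)}"] exI[of _ "\<lambda>_. xm w"]) (auto simp: S_def in_ring_xm)
    qed
    have "bin (A, B) \<in> ideal_span E S" if "(A, B) \<in> gen E P" for A B
    proof -
      define M where "M = {(w + p, w + q) | w p q. set_mset w \<subseteq> E \<and> (p, q) \<in> P}"
      have "move E P = M \<union> M\<inverse>" unfolding move_def M_def by blast
      then have "bin (A, B) \<in> pv.span ((bin :: _ \<Rightarrow> ('v, 'k) epoly) ` M)"
        using that bin_equiv_closure unfolding gen_def by metis
      also have "\<dots> \<subseteq> ideal_span E S"
        by (rule pv.span_minimal[OF _ sub]) (auto simp: M_def intro: base)
      finally show ?thesis .
    qed
    then show ?thesis unfolding toric_ideal_eq_span
      using P(3) by (intro pv.span_minimal[OF _ sub]) auto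
  qed
  moreover have "card S \<le> card P" using P(2) by (simp add: S_def card_image_le)
  ultimately show thesis using that fin ST by blast
qed

section \<open>Alternating walks\<close>

lemma card2_other:
  assumes "card f = 2" "u \<in> f" obtains w where "f = {u, w}" "u \<noteq> w"
  using assms by (auto simp: card_2_iff)

text \<open>If \<open>u\<close> is not \<open>x\<close>, some edge {u, w} lies in \<open>A\<close>;
  once it is removed, the balance of degrees forces an edge {w, z} in \<open>A'\<close>. Exchanging
  the two moves the defect from \<open>u\<close> to \<open>z\<close>. Since \<open>A\<close>
  shrinks, the walk must end at \<open>x\<close>.\<close>

lemma alternating_walk:
  assumes "\<forall>f\<in>#A + A'. card f = 2" "vdeg A' + {#u#} = vdeg A + replicate_mset n x" "n > 0"
  shows "\<exists>C. set_mset C \<subseteq> set_mset (A + A') \<and> vdeg C + {#u#} = vdeg A + {#x#}"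
  using assms
proof (induction "size A" arbitrary: A A' u rule: less_induct)
  case less
  show ?case
  proof (cases "u = x")
    case True then show ?thesis by (intro exI[of _ A]) auto
  next
    case False
    have "u \<in># vdeg A' + {#u#}" by simp
    then have "u \<in># vdeg A + replicate_mset n x" unfolding less.prems(2) .
    then have "u \<in># vdeg A" using False by (simp split: if_splits)
    then obtain f where f: "f \<in># A" "u \<in> f" using in_vdegD by metis
    obtain w where w: "f = {u, w}" "u \<noteq> w" using card2_other[of f u] less.prems(1) f by auto
    obtain A0 where A0: "A = add_mset f A0" using f(1) by (metis mset_add)
    have deg': "vdeg A' = vdeg A0 + {#w#} + replicate_mset n x"
      using less.prems(2) w by (simp add: A0)
    then have "w \<in># vdeg A'" by simp
    then obtain g where g: "g \<in># A'" "w \<in> g" using in_vdegD by metis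
    obtain z where z: "g = {w, z}" "w \<noteq> z" using card2_other[of g w] less.prems(1) g by auto
    obtain A1 where A1: "A' = add_mset g A1" using g(1) by (metis mset_add)
    have "vdeg A1 + {#z#} = vdeg A0 + replicate_mset n x"
      using deg' z by (simp add: A1)
    moreover have "size A0 < size A" by (simp add: A0)
    moreover have "\<forall>f\<in>#A0 + A1. card f = 2" using less.prems(1) by (simp add: A0 A1)
    ultimately obtain C where C: "set_mset C \<subseteq> set_mset (A0 + A1)" "vdeg C + {#z#} = vdeg A0 + {#x#}"
      using less.hyps[of A0 A1 z] less.prems(3) by blast
    \<comment> \<open>Putting {w, z} in place of {u, w} trades \<open>u\<close> for
      \<open>z\<close>, and \<open>C\<close> trades \<open>z\<close> for \<open>x\<close>.\<close>
    show ?thesis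
    proof (intro exI[of _ "add_mset g C"] conjI)
      show "set_mset (add_mset g C) \<subseteq> set_mset (A + A')" using C(1) by (auto simp: A0 A1)
      show "vdeg (add_mset g C) + {#u#} = vdeg A + {#x#}" using C(2) w z by (simp add: A0)
    qed
  qed
qed

text \<open>An edge {x, u} of \<open>A'\<close> is set aside; the walk from \<open>u\<close> back to
  \<open>x\<close> trades a \<open>u\<close> in \<open>A\<close> for an \<open>x\<close>, and
  returning the edge restores \<open>u\<close> and adds the second \<open>x\<close>.\<close>

lemma raise_degree:
  assumes "\<forall>f\<in>E. card f = 2" "set_mset A \<subseteq> E" "set_mset A' \<subseteq> E"
    "vdeg A' = vdeg A + replicate_mset (n + 2) x"
  obtains C where "set_mset C \<subseteq> E" "vdeg C = vdeg A + replicate_mset 2 x"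
proof -
  have "x \<in># vdeg A'" using assms(4) by simp
  then obtain f where f: "f \<in># A'" "x \<in> f" using in_vdegD by metis
  obtain u where u: "f = {x, u}" "x \<noteq> u" by (rule card2_other[of f x]) (use assms f in auto)
  obtain A1 where A1: "A' = add_mset f A1" using f(1) by (metis mset_add)
  \<comment> \<open>The removed edge accounts for one of the \<open>n + 2\<close> surplus copies of
    \<open>x\<close>.\<close>
  have "vdeg A1 + {#u#} = vdeg A + replicate_mset (Suc n) x" using assms(4) u by (simp add: A1)
  moreover have "\<forall>f\<in>#A + A1. card f = 2" using assms by (auto simp: A1)
  ultimately obtain C where C: "set_mset C \<subseteq> set_mset (A + A1)" "vdeg C + {#u#} = vdeg A + {#x#}"
    using alternating_walk[of A A1 u "Suc n" x] by blast
  show thesis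
  proof (rule that[of "add_mset f C"])
    show "set_mset (add_mset f C) \<subseteq> E" using C(1) assms by (auto simp: A1)
    show "vdeg (add_mset f C) = vdeg A + replicate_mset 2 x" using C(2) u by (simp add: numeral_2_eq_2)
  qed
qed

lemma raise_degree_even:
  assumes "\<forall>f\<in>E. card f = 2" "set_mset A \<subseteq> E" "set_mset A' \<subseteq> E"
    "vdeg A' = vdeg A + replicate_mset (2 * n) x" "j \<le> n"
  shows "\<exists>C. set_mset C \<subseteq> E \<and> vdeg C = vdeg A + replicate_mset (2 * j) x"
  using assms(5)
proof (induction j)
  case 0 then show ?case using assms(2) by auto
next
  case (Suc j)
  then obtain C where C: "set_mset C \<subseteq> E" "vdeg C = vdeg A + replicate_mset (2 * j) x" by auto
  obtain i where "n = j + 1 + i" using Suc.prems by (metis le_Suc_ex Suc_eq_plus1)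
  then have "vdeg A' = vdeg C + replicate_mset (2 * i + 2) x"
    using assms(4) C(2) by (auto simp: multiset_eq_iff)
  then obtain C' where "set_mset C' \<subseteq> E" "vdeg C' = vdeg C + replicate_mset 2 x"
    using raise_degree[OF assms(1) C(1) assms(3)] by metis
  then show ?case using C(2) by (intro exI[of _ C']) (auto simp: multiset_eq_iff)
qed

lemma gen_hom:
  assumes "(A, B) \<in> gen E P"
    and "\<And>M N. h (M + N) = h M + h N"
    and "\<And>w. set_mset w \<subseteq> E \<Longrightarrow> set_mset (h w) \<subseteq> F"
    and "\<And>p q. (p, q) \<in> P \<Longrightarrow> (h p, h q) \<in> R \<union> R\<inverse>"
  shows "(h A, h B) \<in> gen F R"
  using assms(1) unfolding gen_def
proof (induction rule: rtrancl_induct)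
  case (step B C)
  obtain u p q where u: "B = u + p" "C = u + q" "set_mset u \<subseteq> E" "(p, q) \<in> P \<union> P\<inverse>"
    using step(2) unfolding move_def by auto
  then have "(h p, h q) \<in> R \<union> R\<inverse>" using assms(4)[of p q] assms(4)[of q p] by auto
  then have "(h B, h C) \<in> move F R"
    unfolding move_def using assms(3)[OF u(3)] by (auto simp: u(1,2) assms(2))
  with step(3) show ?case by (rule rtrancl_into_rtrancl)
qed simp

section \<open>Quadruples common to the bridge and its contraction\<close>

locale bridge =
  fixes V1 V2 :: "'v set" and E1 E2 :: "'v set set" and x y y0 :: 'v
  assumes E1: "f \<in> E1 \<Longrightarrow> f \<subseteq> V1 \<and> card f = 2"
    and E2: "f \<in> E2 \<Longrightarrow> f \<subseteq> V2 \<and> card f = 2"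
    and disj: "V1 \<inter> V2 = {}"
    and x: "x \<in> V1" and y: "y \<in> V2" and y0: "y0 \<notin> V1 \<union> V2"
begin

text \<open>Pairs in the two parts whose degrees are raised by n at x and at y simultaneously.\<close>

definition D :: "nat \<Rightarrow> ('v set multiset \<times> 'v set multiset \<times> 'v set multiset \<times> 'v set multiset) set" where
  "D n = {(A, A', B, B'). set_mset A \<subseteq> E1 \<and> set_mset A' \<subseteq> E1 \<and> set_mset B \<subseteq> E2 \<and> set_mset B' \<subseteq> E2 \<and>
     vdeg A' = vdeg A + replicate_mset n x \<and> vdeg B' = vdeg B + replicate_mset n y}"

text \<open>A crossing quadruple, multiplied by \<open>c\<close> and \<open>d\<close>, has to match
  degrees only: the first two clauses connect all monomials of equal degree within each
  part.\<close>

definition complete :: "('v set multiset \<times> 'v set multiset \<times> 'v set multiset \<times> 'v set multiset) set \<Rightarrow> bool" where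
  "complete W \<longleftrightarrow>
     fib E1 \<subseteq> gen E1 {(a, a'). (a, a', {#}, {#}) \<in> W} \<and>
     fib E2 \<subseteq> gen E2 {(b, b'). ({#}, {#}, b, b') \<in> W} \<and>
     (\<forall>A A' B B'. (A, A', B, B') \<in> D 2 \<longrightarrow>
        (\<exists>a a' b b' c d. (a, a', b, b') \<in> W \<and> set_mset c \<subseteq> E1 \<and> set_mset d \<subseteq> E2 \<and>
           vdeg (a + c) = vdeg A \<and> vdeg (a' + c) = vdeg A' \<and>
           vdeg (b + d) = vdeg B \<and> vdeg (b' + d) = vdeg B'))"

text \<open>Handshake count: each edge adds 2 to the size of the degree.\<close>

lemma D_even: assumes "(A, A', B, B') \<in> D n" shows "even n"
proof -
  have "size (vdeg A) = 2 * size A" "size (vdeg A') = 2 * size A'"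
    using assms E1 by (intro size_vdeg; auto simp: D_def)+
  moreover have "size (vdeg A') = size (vdeg A) + n" using assms by (simp add: D_def)
  ultimately show ?thesis by presburger
qed

lemma vdeg_E1: "set_mset A \<subseteq> E1 \<Longrightarrow> set_mset (vdeg A) \<subseteq> V1"
  using in_vdegD[of _ A] E1 by blast

lemma vdeg_E2: "set_mset A \<subseteq> E2 \<Longrightarrow> set_mset (vdeg A) \<subseteq> V2"
  using in_vdegD[of _ A] E2 by blast

lemma edges_card2: "card f = 2" if "f \<in> E1 \<union> E2"
  using that E1 E2 by auto

text \<open>There are no loops. This keeps monomials of one part pure after contraction, where the
  degree at the merged vertex no longer tells the parts apart.\<close>

lemma edges_at_single_vertex:
  assumes "set_mset A \<subseteq> E1 \<union> E2" "set_mset (vdeg A) \<subseteq> {v}" shows "A = {#}"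
proof (rule ccontr)
  assume "A \<noteq> {#}"
  then obtain f where f: "f \<in># A" by blast
  then have "card f = 2" using assms(1) edges_card2 by auto
  then obtain a b where "f = {a, b}" "a \<noteq> b" by (auto simp: card_2_iff)
  then have "a \<in># vdeg A" "b \<in># vdeg A" using in_vdegI[OF f] by auto
  then show False using assms(2) \<open>a \<noteq> b\<close> by auto
qed

end

text \<open>The flag twists the second part: over the bridge both degrees rise together, whereas after
  contraction the degree gained at x by the first part is lost at y by the second one.\<close>

definition quad :: "bool \<Rightarrow> ('m \<Rightarrow> 'a) \<Rightarrow> ('m \<Rightarrow> 'b) \<Rightarrow> 'm \<Rightarrow> 'm \<Rightarrow> 'a \<times> 'a \<times> 'b \<times> 'b" where
  "quad tw pr1 pr2 M N = (pr1 M, pr1 N, if tw then pr2 N else pr2 M, if tw then pr2 M else pr2 N)"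

text \<open>The interface through which one argument serves both graphs. \<open>F\<close> is the
  edge set, \<open>pr1\<close> and \<open>pr2\<close> extract the monomials of the two parts, and
  \<open>F1\<close>, \<open>F2\<close> are meant as the copies of \<open>E1\<close>,
  \<open>E2\<close> inside \<open>F\<close>. \<open>mid\<close> splits long jumps, \<open>ex\<close>
  realises every jump by 2, and the purity assumptions confine a fibre that contains a monomial of
  one part to that part.\<close>

locale presentation = bridge V1 V2 E1 E2 x y y0
  for V1 V2 :: "'v set" and E1 E2 x y y0 +
  fixes F F1 F2 :: "'v set set" and pr1 pr2 :: "'v set multiset \<Rightarrow> 'v set multiset" and tw :: bool
  assumes pr1_add: "pr1 (M + N) = pr1 M + pr1 N" and pr2_add: "pr2 (M + N) = pr2 M + pr2 N"
    and pr1_sub: "set_mset M \<subseteq> F \<Longrightarrow> set_mset (pr1 M) \<subseteq> E1"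
    and pr2_sub: "set_mset M \<subseteq> F \<Longrightarrow> set_mset (pr2 M) \<subseteq> E2"
    and fibD: "(M, N) \<in> fib F \<Longrightarrow> \<exists>n. quad tw pr1 pr2 M N \<in> D n \<or> quad tw pr1 pr2 N M \<in> D n"
    and mid: "(M, N) \<in> fib F \<Longrightarrow> quad tw pr1 pr2 M N \<in> D (2 * n + 2) \<Longrightarrow>
      \<exists>L. (M, L) \<in> fib F \<and> quad tw pr1 pr2 M L \<in> D 2 \<and> quad tw pr1 pr2 L N \<in> D (2 * n)"
    and ex: "q \<in> D 2 \<Longrightarrow> \<exists>M N. (M, N) \<in> fib F \<and> quad tw pr1 pr2 M N = q"
    and pure1_ex: "(A, A') \<in> fib E1 \<Longrightarrow> \<exists>M N. (M, N) \<in> fib F \<and> pr1 M = A \<and> pr1 N = A' \<and> set_mset M \<subseteq> F1"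
    and pure2_ex: "(B, B') \<in> fib E2 \<Longrightarrow> \<exists>M N. (M, N) \<in> fib F \<and> pr2 M = B \<and> pr2 N = B' \<and> set_mset M \<subseteq> F2"
    and pure1: "set_mset M \<subseteq> F1 \<Longrightarrow> pr2 M = {#}" and pure2: "set_mset M \<subseteq> F2 \<Longrightarrow> pr1 M = {#}"
    and pure1_fib: "(M, N) \<in> fib F \<Longrightarrow> set_mset M \<subseteq> F1 \<Longrightarrow> set_mset N \<subseteq> F1"
    and pure2_fib: "(M, N) \<in> fib F \<Longrightarrow> set_mset M \<subseteq> F2 \<Longrightarrow> set_mset N \<subseteq> F2"
begin

abbreviation "qd \<equiv> quad tw pr1 pr2"

text \<open>The prescribed binomials for the Nakayama argument. A jump by 2 is oriented so that the
  first part gains degree at \<open>x\<close>.\<close>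

definition Q :: "('v set multiset \<times> 'v set multiset) set" where
  "Q = {(M, N) \<in> fib F. qd M N \<in> D 0 \<union> D 2}"

text \<open>A jump by \<open>2 * n\<close> is cut into jumps of 2 by repeated use of
  \<open>mid\<close>; parity excludes any other jump.\<close>

lemma fib_subset_closure: "fib F \<subseteq> (Q \<union> Q\<inverse>)\<^sup>*"
proof -
  have up: "(M, N) \<in> (Q \<union> Q\<inverse>)\<^sup>*" if "(M, N) \<in> fib F" "qd M N \<in> D (2 * n)" for M N n
    using that
  proof (induction n arbitrary: M)
    case 0 then show ?case by (auto simp: Q_def)
  next
    case (Suc n)
    then obtain L where L: "(M, L) \<in> fib F" "qd M L \<in> D 2" "qd L N \<in> D (2 * n)"
      using mid[of M N n] by auto
    have "(L, N) \<in> fib F" using L(1) Suc.prems(1) fib_sym fib_trans by blast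
    then have "(L, N) \<in> (Q \<union> Q\<inverse>)\<^sup>*" using Suc.IH L(3) by blast
    moreover have "(M, L) \<in> Q" using L by (simp add: Q_def)
    ultimately show ?case by (meson UnI1 converse_rtrancl_into_rtrancl)
  qed
  have sym: "(A, B) \<in> (Q \<union> Q\<inverse>)\<^sup>* \<Longrightarrow> (B, A) \<in> (Q \<union> Q\<inverse>)\<^sup>*" for A B
    by (rule symD[OF sym_rtrancl]) (auto intro: symI)
  show ?thesis
  proof (rule subrelI)
    fix M N assume MN: "(M, N) \<in> fib F"
    obtain n where n: "qd M N \<in> D n \<or> qd N M \<in> D n" using fibD[OF MN] by blast
    then have "even n" using D_even unfolding quad_def by blast
    then obtain k where "n = 2 * k" by blast
    then show "(M, N) \<in> (Q \<union> Q\<inverse>)\<^sup>*" using n MN up sym fib_sym by metis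
  qed
qed

text \<open>Within one fibre, the degree at \<open>x\<close> of the first part determines the
  degrees of both parts, since the jump between two monomials is visible there.\<close>

lemma same_level:
  assumes "(M, N) \<in> fib F" "count (vdeg (pr1 M)) x = count (vdeg (pr1 N)) x"
  shows "vdeg (pr1 M) = vdeg (pr1 N)" "vdeg (pr2 M) = vdeg (pr2 N)"
proof -
  obtain n where n: "qd M N \<in> D n \<or> qd N M \<in> D n" using fibD[OF assms(1)] by blast
  then have "n = 0" using assms(2) by (auto simp: D_def quad_def)
  then show "vdeg (pr1 M) = vdeg (pr1 N)" "vdeg (pr2 M) = vdeg (pr2 N)"
    using n by (auto simp: D_def quad_def split: if_splits)
qed

text \<open>Moves preserve the degree, so a path that starts at a pure monomial stays pure. Every
  generator used on it divides a pure monomial and is therefore pure as well.\<close>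

lemma pure_gen:
  assumes P: "P \<subseteq> fib F" "(M, N) \<in> gen F P" "set_mset M \<subseteq> F" "set_mset M \<subseteq> F'"
    and pr: "\<And>M N. pr (M + N) = pr M + pr N" "\<And>M. set_mset M \<subseteq> F \<Longrightarrow> set_mset (pr M) \<subseteq> E"
    and fib: "\<And>M N. (M, N) \<in> fib F \<Longrightarrow> set_mset M \<subseteq> F' \<Longrightarrow> set_mset N \<subseteq> F'"
    and R: "\<And>p q. (p, q) \<in> P \<Longrightarrow> set_mset p \<subseteq> F' \<Longrightarrow> set_mset q \<subseteq> F' \<Longrightarrow> (pr p, pr q) \<in> R \<union> R\<inverse>"
  shows "(pr M, pr N) \<in> gen E R"
proof -
  have "(pr M, pr N) \<in> gen E R \<and> set_mset N \<subseteq> F'"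
    using P(2) unfolding gen_def
  proof (induction rule: rtrancl_induct)
    case base then show ?case using P(4) by simp
  next
    case (step N L)
    obtain w p q where w: "N = w + p" "L = w + q" "set_mset w \<subseteq> F" "(p, q) \<in> P \<union> P\<inverse>"
      using step(2) unfolding move_def by auto
    have N: "set_mset N \<subseteq> F'" using step(3) by blast
    have "(N, L) \<in> fib F" by (rule move_fib[OF P(1) step(2)])
    then have L: "set_mset L \<subseteq> F'" using N fib by blast
    then have "(pr p, pr q) \<in> R \<union> R\<inverse>" using N w(4) R[of p q] R[of q p] by (auto simp: w(1,2))
    then have "(pr N, pr L) \<in> move E R"
      unfolding move_def using pr(2)[OF w(3)] by (auto simp: w(1,2) pr(1))
    then show ?case using step(3) L by (meson rtrancl_into_rtrancl)
  qed
  then show ?thesis by blast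
qed

text \<open>Along a path, the degree at x of the first part changes by at most 2 per step, so a path
  between levels l and l + 2 contains a step that crosses from l to l + 2 exactly.\<close>

lemma crossing:
  assumes P: "P \<subseteq> Q" and M: "(M, N) \<in> fib F" "(M, N) \<in> gen F P" "qd M N \<in> D 2"
  shows "\<exists>w p q. set_mset w \<subseteq> F \<and> (p, q) \<in> P \<and>
    vdeg (pr1 (w + p)) = vdeg (pr1 M) \<and> vdeg (pr2 (w + p)) = vdeg (pr2 M) \<and>
    vdeg (pr1 (w + q)) = vdeg (pr1 N) \<and> vdeg (pr2 (w + q)) = vdeg (pr2 N)" (is ?C)
proof -
  define l where "l K = count (vdeg (pr1 K)) x" for K
  have PF: "P \<subseteq> fib F" using P by (auto simp: Q_def)
  have lN: "l N = l M + 2" using M(3) by (simp add: l_def D_def quad_def)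
  \<comment> \<open>Invariant of a path without the required crossing: it never rises above the
    level of \<open>M\<close>, and it keeps the parity of that level.\<close>
  have "(M, L) \<in> fib F \<and> (?C \<or> (l L \<le> l M \<and> even (l M - l L)))" if "(M, L) \<in> gen F P" for L
    using that unfolding gen_def
  proof (induction rule: rtrancl_induct)
    case base show ?case using M(1) by (simp add: fib_def)
  next
    case (step K L)
    have fKL: "(K, L) \<in> fib F" by (rule move_fib[OF PF step(2)])
    then have fML: "(M, L) \<in> fib F" using step(3) fib_trans by blast
    obtain w p q where w: "K = w + p" "L = w + q" "set_mset w \<subseteq> F" "(p, q) \<in> P \<union> P\<inverse>"
      using step(2) unfolding move_def by auto
    have lw: "l (w + r) = l w + l r" for r by (simp add: l_def pr1_add)
    have pq: "l s = l r \<or> l s = l r + 2" if "(r, s) \<in> P" for r s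
      using that P by (auto simp: l_def Q_def quad_def D_def)
    consider "?C" | "l K \<le> l M" "even (l M - l K)" using step(3) by blast
    then show ?case
    proof cases
      case 2
      show ?thesis
      proof (cases "(p, q) \<in> P \<and> l q = l p + 2 \<and> l K = l M")
        case True
        then have "l L = l N" using lN by (simp add: w lw)
        moreover have "(L, N) \<in> fib F" "(K, M) \<in> fib F" using fML M(1) step(3) fib_sym fib_trans by blast+
        ultimately have ?C using True w same_level[of L N] same_level[of K M]
          by (intro exI[of _ w] exI[of _ p] exI[of _ q]) (auto simp: l_def)
        then show ?thesis using fML by blast
      next
        case False
        \<comment> \<open>A rise from exactly the level of \<open>M\<close> is excluded here, being
          the crossing itself; from a lower level of the same parity, a rise by 2 still ends at or
          below it.\<close>
        have "l L = l K \<or> l K = l L + 2 \<or> (l L = l K + 2 \<and> l K < l M)"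
          using False w(4) pq[of p q] pq[of q p] 2 by (auto simp: w(1,2) lw)
        then have "l L \<le> l M \<and> even (l M - l L)" using 2 by presburger
        then show ?thesis using fML by blast
      qed
    qed (use fML in blast)
  qed
  \<comment> \<open>\<open>N\<close> lies 2 above \<open>M\<close>, which violates the
    invariant.\<close>
  from this[OF M(2)] show ?thesis using lN by auto
qed

text \<open>Paths between pure monomials give the two clauses on the parts, and the unavoidable step
  on a path across a jump by 2 gives the third.\<close>

lemma generators_complete:
  assumes P: "P \<subseteq> Q" "fib F \<subseteq> gen F P"
  shows "complete (case_prod qd ` P)" "case_prod qd ` P \<subseteq> D 0 \<union> D 2"
proof -
  let ?W = "case_prod qd ` P"
  have PF: "P \<subseteq> fib F" using P by (auto simp: Q_def)
  show "?W \<subseteq> D 0 \<union> D 2" using P(1) by (auto simp: Q_def)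
  show "complete ?W" unfolding complete_def
  proof (intro conjI allI impI)
    show "fib E1 \<subseteq> gen E1 {(a, a'). (a, a', {#}, {#}) \<in> ?W}"
    proof (rule subrelI)
      fix A A' assume "(A, A') \<in> fib E1"
      then obtain M N where M: "(M, N) \<in> fib F" "pr1 M = A" "pr1 N = A'" "set_mset M \<subseteq> F1"
        using pure1_ex by blast
      have "(pr1 M, pr1 N) \<in> gen E1 {(a, a'). (a, a', {#}, {#}) \<in> ?W}"
      proof (rule pure_gen[OF PF _ _ M(4) pr1_add pr1_sub pure1_fib])
        fix p q assume "(p, q) \<in> P" "set_mset p \<subseteq> F1" "set_mset q \<subseteq> F1"
        then have "qd p q \<in> ?W" "qd p q = (pr1 p, pr1 q, {#}, {#})"
          using pure1[of p] pure1[of q] by (force, simp add: quad_def)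
        then have "(pr1 p, pr1 q, {#}, {#}) \<in> ?W" by (simp only:)
        then show "(pr1 p, pr1 q) \<in> {(a, a'). (a, a', {#}, {#}) \<in> ?W} \<union> {(a, a'). (a, a', {#}, {#}) \<in> ?W}\<inverse>"
          by blast
      qed (use M P(2) in \<open>auto simp: fib_def\<close>)
      then show "(A, A') \<in> gen E1 {(a, a'). (a, a', {#}, {#}) \<in> ?W}" using M by simp
    qed
    show "fib E2 \<subseteq> gen E2 {(b, b'). ({#}, {#}, b, b') \<in> ?W}"
    proof (rule subrelI)
      fix B B' assume "(B, B') \<in> fib E2"
      then obtain M N where M: "(M, N) \<in> fib F" "pr2 M = B" "pr2 N = B'" "set_mset M \<subseteq> F2"
        using pure2_ex by blast
      have "(pr2 M, pr2 N) \<in> gen E2 {(b, b'). ({#}, {#}, b, b') \<in> ?W}"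
      proof (rule pure_gen[OF PF _ _ M(4) pr2_add pr2_sub pure2_fib])
        fix p q assume "(p, q) \<in> P" "set_mset p \<subseteq> F2" "set_mset q \<subseteq> F2"
        \<comment> \<open>The twist reverses the second pair, so the generator may appear with its
          sides exchanged.\<close>
        then have "qd p q \<in> ?W" "qd p q = ({#}, {#}, pr2 p, pr2 q) \<or> qd p q = ({#}, {#}, pr2 q, pr2 p)"
          using pure2[of p] pure2[of q] by (force, simp add: quad_def)
        then have "({#}, {#}, pr2 p, pr2 q) \<in> ?W \<or> ({#}, {#}, pr2 q, pr2 p) \<in> ?W" by metis
        then show "(pr2 p, pr2 q) \<in> {(b, b'). ({#}, {#}, b, b') \<in> ?W} \<union> {(b, b'). ({#}, {#}, b, b') \<in> ?W}\<inverse>"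
          by blast
      qed (use M P(2) in \<open>auto simp: fib_def\<close>)
      then show "(B, B') \<in> gen E2 {(b, b'). ({#}, {#}, b, b') \<in> ?W}" using M by simp
    qed
    fix A A' B B' assume "(A, A', B, B') \<in> D 2"
    then obtain M N where MN: "(M, N) \<in> fib F" "qd M N = (A, A', B, B')" "qd M N \<in> D 2"
      using ex by metis
    then obtain w p q where w: "set_mset w \<subseteq> F" "(p, q) \<in> P"
      "vdeg (pr1 (w + p)) = vdeg (pr1 M)" "vdeg (pr2 (w + p)) = vdeg (pr2 M)"
      "vdeg (pr1 (w + q)) = vdeg (pr1 N)" "vdeg (pr2 (w + q)) = vdeg (pr2 N)"
      using crossing[OF P(1) MN(1) _ MN(3)] P(2) by blast
    obtain a a' b b' where q: "qd p q = (a, a', b, b')" by (metis prod_cases4)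
    show "\<exists>a a' b b' c d. (a, a', b, b') \<in> ?W \<and> set_mset c \<subseteq> E1 \<and> set_mset d \<subseteq> E2 \<and>
           vdeg (a + c) = vdeg A \<and> vdeg (a' + c) = vdeg A' \<and>
           vdeg (b + d) = vdeg B \<and> vdeg (b' + d) = vdeg B'"
    \<comment> \<open>The cofactor \<open>w\<close> of the crossing move splits into
      \<open>c\<close> and \<open>d\<close>, its two parts.\<close>
    proof (intro exI conjI)
      show "(a, a', b, b') \<in> ?W" using w(2) q by force
      show "set_mset (pr1 w) \<subseteq> E1" "set_mset (pr2 w) \<subseteq> E2" using w(1) pr1_sub pr2_sub by auto
    qed (use w(3-) q MN(2) in \<open>auto simp: quad_def pr1_add pr2_add ac_simps split: if_splits\<close>)
  qed
qed

end

lemma image_mset_preimage: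
  assumes "set_mset M \<subseteq> f ` T" shows "\<exists>A. M = image_mset f A \<and> set_mset A \<subseteq> T"
  using assms
proof (induction M)
  case (add m M)
  then obtain A t where "M = image_mset f A" "set_mset A \<subseteq> T" "m = f t" "t \<in> T" by auto
  then show ?case by (intro exI[of _ "add_mset t A"]) simp
qed simp

text \<open>Generators may be replaced by no more binomials from \<open>Q\<close>, and passing to
  quadruples does not increase their number.\<close>

lemma (in presentation) complete_of_toric_generators:
  fixes S :: "('v, 'k::field) epoly set"
  assumes "\<forall>f\<in>F. card f = 2" "finite S" "S \<subseteq> toric_ideal F" "ideal_span F S = toric_ideal F"
  shows "\<exists>W. finite W \<and> card W \<le> card S \<and> W \<subseteq> D 0 \<union> D 2 \<and> complete W"
proof -
  have "Q \<subseteq> fib F" by (auto simp: Q_def)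
  from toric_generators_imp_gen[OF assms this fib_subset_closure]
  obtain P where P: "P \<subseteq> Q" "finite P" "card P \<le> card S" "fib F \<subseteq> gen F P" .
  then show ?thesis
    using generators_complete[OF P(1,4)] card_image_le[OF P(2), of "case_prod qd"]
    by (intro exI[of _ "case_prod qd ` P"]) auto
qed

context bridge
begin

section \<open>The graph with the bridge\<close>

abbreviation "EG \<equiv> E1 \<union> E2 \<union> {{x, y}}"
abbreviation "r1 \<equiv> filter_mset (\<lambda>f. f \<in> E1)"
abbreviation "r2 \<equiv> filter_mset (\<lambda>f. f \<in> E2)"
abbreviation "xy n \<equiv> replicate_mset n {x, y}"

lemma x_neq_y: "x \<noteq> y"
  using x y disj by blast

lemma bridge_notin: "{x, y} \<notin> E1" "{x, y} \<notin> E2"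
  using E1 E2 x y disj by blast+

lemma E12_disj: assumes "f \<in> E1" "f \<in> E2" shows False
proof -
  have "f = {}" using assms E1[of f] E2[of f] disj by blast
  then show False using assms E1[of f] by auto
qed

lemma EG_card2: "\<forall>f\<in>EG. card f = 2"
  using edges_card2 x_neq_y by auto

lemma filter_subset: "set_mset A \<subseteq> T \<Longrightarrow> filter_mset (\<lambda>f. f \<in> T) A = A"
  by (simp add: filter_mset_eq_conv subset_iff)

lemma filter_disjoint: "set_mset A \<inter> T = {} \<Longrightarrow> filter_mset (\<lambda>f. f \<in> T) A = {#}"
  by (simp add: filter_mset_eq_conv disjoint_iff)

lemma r1_E1: "set_mset A \<subseteq> E1 \<Longrightarrow> r1 A = A" and r2_E1: "set_mset A \<subseteq> E1 \<Longrightarrow> r2 A = {#}"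
  and r2_E2: "set_mset B \<subseteq> E2 \<Longrightarrow> r2 B = B" and r1_E2: "set_mset B \<subseteq> E2 \<Longrightarrow> r1 B = {#}"
  using E12_disj by (blast intro: filter_subset filter_disjoint)+

lemma r_xy: "r1 (xy n) = {#}" "r2 (xy n) = {#}"
  by (rule filter_disjoint, use bridge_notin in auto)+

lemmas r_simps = r1_E1 r2_E1 r2_E2 r1_E2 r_xy

lemma G_decomp: assumes "set_mset M \<subseteq> EG" shows "M = r1 M + r2 M + xy (count M {x, y})"
proof (rule multiset_eqI)
  fix f
  show "count M f = count (r1 M + r2 M + xy (count M {x, y})) f"
  proof (cases "f \<in># M")
    case True
    then consider "f \<in> E1" | "f \<in> E2" | "f = {x, y}" using assms by auto
    then show ?thesis using bridge_notin E12_disj by cases auto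
  next
    case False
    then show ?thesis by (auto simp: not_in_iff)
  qed
qed

lemma E12_decomp: assumes "set_mset K \<subseteq> E1 \<union> E2" shows "r1 K + r2 K = K"
proof -
  have "r2 K = filter_mset (\<lambda>f. f \<notin> E1) K"
    using assms E12_disj by (intro filter_mset_cong) auto
  then show ?thesis using multiset_partition[of K "\<lambda>f. f \<in> E1"] by simp
qed

lemma vdeg_xy: "vdeg (xy n) = replicate_mset n x + replicate_mset n y"
  using x_neq_y by (induction n) auto

lemma separate:
  assumes "X + Y = X' + Y'" "set_mset X \<subseteq> V1" "set_mset X' \<subseteq> V1" "set_mset Y \<subseteq> V2" "set_mset Y' \<subseteq> V2"
  shows "X = X'" "Y = Y'"
proof -
  have "filter_mset (\<lambda>v. v \<in> V1) (X + Y) = filter_mset (\<lambda>v. v \<in> V1) (X' + Y')" using assms(1) by simp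
  moreover have "filter_mset (\<lambda>v. v \<in> V1) Y = {#}" "filter_mset (\<lambda>v. v \<in> V1) Y' = {#}"
    using assms disj by (auto simp: filter_mset_eq_conv)
  ultimately show "X = X'" using filter_subset[OF assms(2)] filter_subset[OF assms(3)] by simp
  then show "Y = Y'" using assms(1) by simp
qed

lemma replicate_cancel:
  assumes "X + replicate_mset k v = X' + replicate_mset l v" "k \<le> l"
  shows "X = X' + replicate_mset (l - k) v"
proof (rule multiset_eqI)
  fix u show "count X u = count (X' + replicate_mset (l - k) v) u"
    using arg_cong[OF assms(1), of "\<lambda>X. count X u"] assms(2) by (auto split: if_splits)
qed

text \<open>Each copy of the bridge contributes one \<open>x\<close> and one \<open>y\<close>; the
  disjoint vertex sets then let the degrees be compared in each part separately.\<close>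

lemma G_fib:
  assumes "(M, N) \<in> fib EG"
  shows "vdeg (r1 M) + replicate_mset (count M {x, y}) x = vdeg (r1 N) + replicate_mset (count N {x, y}) x"
    "vdeg (r2 M) + replicate_mset (count M {x, y}) y = vdeg (r2 N) + replicate_mset (count N {x, y}) y"
proof -
  have eq: "vdeg K = (vdeg (r1 K) + replicate_mset (count K {x, y}) x) + (vdeg (r2 K) + replicate_mset (count K {x, y}) y)"
    if "set_mset K \<subseteq> EG" for K
    using arg_cong[OF G_decomp[OF that], of vdeg] by (simp add: vdeg_xy ac_simps)
  have "(vdeg (r1 M) + replicate_mset (count M {x, y}) x) + (vdeg (r2 M) + replicate_mset (count M {x, y}) y)
    = (vdeg (r1 N) + replicate_mset (count N {x, y}) x) + (vdeg (r2 N) + replicate_mset (count N {x, y}) y)"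
    using eq[of M] eq[of N] assms by (simp add: fib_def)
  note sep = separate[OF this]
  have "set_mset (vdeg (r1 K) + replicate_mset n x) \<subseteq> V1" "set_mset (vdeg (r2 K) + replicate_mset n y) \<subseteq> V2" for K n
    using vdeg_E1[of "r1 K"] vdeg_E2[of "r2 K"] x y by (auto split: if_splits)
  from sep[OF this(1,1,2,2)]
  show "vdeg (r1 M) + replicate_mset (count M {x, y}) x = vdeg (r1 N) + replicate_mset (count N {x, y}) x"
    "vdeg (r2 M) + replicate_mset (count M {x, y}) y = vdeg (r2 N) + replicate_mset (count N {x, y}) y" .
qed

lemma D_intermediate:
  assumes "(A, A', B, B') \<in> D (2 * n)" "j \<le> n"
  obtains A1 B1 where "(A, A1, B, B1) \<in> D (2 * j)" "(A1, A', B1, B') \<in> D (2 * (n - j))"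
proof -
  have *: "set_mset A \<subseteq> E1" "set_mset A' \<subseteq> E1" "set_mset B \<subseteq> E2" "set_mset B' \<subseteq> E2"
    "vdeg A' = vdeg A + replicate_mset (2 * n) x" "vdeg B' = vdeg B + replicate_mset (2 * n) y"
    using assms(1) by (auto simp: D_def)
  obtain A1 where A1: "set_mset A1 \<subseteq> E1" "vdeg A1 = vdeg A + replicate_mset (2 * j) x"
    using raise_degree_even[OF _ *(1,2,5) assms(2)] E1 by blast
  obtain B1 where B1: "set_mset B1 \<subseteq> E2" "vdeg B1 = vdeg B + replicate_mset (2 * j) y"
    using raise_degree_even[OF _ *(3,4,6) assms(2)] E2 by blast
  have "replicate_mset (2 * n) v = replicate_mset (2 * j) v + replicate_mset (2 * (n - j)) v" for v :: 'v
    using assms(2) by (auto simp: multiset_eq_iff)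
  then show thesis using * A1 B1 by (intro that[of A1 B1]) (auto simp: D_def ac_simps)
qed

text \<open>The gains at \<open>x\<close> and \<open>y\<close> are balanced by \<open>n\<close>
  extra copies of the bridge on the lower side.\<close>

lemma G_fibI:
  assumes "(A, A', B, B') \<in> D n"
  shows "(A + B + xy (k + n), A' + B' + xy k) \<in> fib EG"
proof -
  have "replicate_mset (k + n) v = replicate_mset k v + replicate_mset n v" for v :: 'v
    by (auto simp: multiset_eq_iff)
  then show ?thesis using assms by (auto simp: fib_def D_def vdeg_xy ac_simps split: if_splits)
qed

lemma G_level:
  assumes "(M, N) \<in> fib EG" "(r1 M, r1 N, r2 M, r2 N) \<in> D n"
  shows "count M {x, y} = count N {x, y} + n"
  using arg_cong[OF G_fib(1)[OF assms(1)], of "\<lambda>X. count X x"] assms(2) by (simp add: D_def)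

lemma G_presentation: "presentation V1 V2 E1 E2 x y y0 EG E1 E2 r1 r2 False"
proof unfold_locales
  fix M N assume MN: "(M, N) \<in> fib EG"
  show "\<exists>n. quad False r1 r2 M N \<in> D n \<or> quad False r1 r2 N M \<in> D n"
  proof (cases "count M {x, y} \<le> count N {x, y}")
    case True
    then have "(r1 N, r1 M, r2 N, r2 M) \<in> D (count N {x, y} - count M {x, y})"
      using replicate_cancel[OF G_fib(1)[OF MN]] replicate_cancel[OF G_fib(2)[OF MN]]
      by (auto simp: D_def)
    then show ?thesis by (auto simp: quad_def)
  next
    case False
    then have "(r1 M, r1 N, r2 M, r2 N) \<in> D (count M {x, y} - count N {x, y})"
      using replicate_cancel[OF G_fib(1)[OF MN, symmetric]] replicate_cancel[OF G_fib(2)[OF MN, symmetric]]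
      by (auto simp: D_def)
    then show ?thesis by (auto simp: quad_def)
  qed
  {
    fix n assume "quad False r1 r2 M N \<in> D (2 * n + 2)"
    then have D: "(r1 M, r1 N, r2 M, r2 N) \<in> D (2 * Suc n)" by (simp add: quad_def)
    obtain A1 B1 where A1: "(r1 M, A1, r2 M, B1) \<in> D (2 * 1)" "(A1, r1 N, B1, r2 N) \<in> D (2 * (Suc n - 1))"
      by (rule D_intermediate[OF D, of 1]) auto
    \<comment> \<open>\<open>L\<close> has two bridges fewer than \<open>M\<close>; they pay for the
      rise to \<open>A1\<close> and \<open>B1\<close>.\<close>
    define k where "k = count N {x, y} + 2 * n"
    have k: "count M {x, y} = k + 2 * 1" using G_level[OF MN D] by (simp add: k_def)
    define L where "L = A1 + B1 + xy k"
    have "set_mset M \<subseteq> EG" using MN by (simp add: fib_def)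
    from G_decomp[OF this] have M: "M = r1 M + r2 M + xy (k + 2 * 1)" unfolding k .
    have "(M, L) \<in> fib EG" unfolding L_def by (subst M) (rule G_fibI[OF A1(1)])
    moreover have "r1 L = A1" "r2 L = B1"
      using A1(1) by (auto simp: L_def D_def r_simps)
    ultimately show "\<exists>L. (M, L) \<in> fib EG \<and> quad False r1 r2 M L \<in> D 2 \<and> quad False r1 r2 L N \<in> D (2 * n)"
      using A1 by (intro exI[of _ L]) (simp add: quad_def)
  }
  {
    assume M: "set_mset M \<subseteq> E1"
    show "set_mset N \<subseteq> E1"
    proof
      fix f assume f: "f \<in># N"
      show "f \<in> E1"
      proof (rule ccontr)
        assume "f \<notin> E1"
        then have "f \<in> E2 \<or> f = {x, y}" using f MN by (auto simp: fib_def)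
        \<comment> \<open>An edge outside \<open>E1\<close>, the bridge included, has an endpoint in
          \<open>V2\<close>, but the degree of \<open>M\<close> lives on \<open>V1\<close>.\<close>
        then obtain v where "v \<in> f" "v \<in> V2" "finite f" using E2[of f] y
          by (auto simp: card_2_iff)
        then have "v \<in># vdeg N" using in_vdegI f by metis
        then have "v \<in># vdeg M" using MN by (simp add: fib_def)
        then show False using vdeg_E1[OF M] \<open>v \<in> V2\<close> disj by blast
      qed
    qed
  }
  {
    assume M: "set_mset M \<subseteq> E2"
    show "set_mset N \<subseteq> E2"
    proof
      fix f assume f: "f \<in># N"
      show "f \<in> E2"
      proof (rule ccontr)
        assume "f \<notin> E2"
        then have "f \<in> E1 \<or> f = {x, y}" using f MN by (auto simp: fib_def)
        then obtain v where "v \<in> f" "v \<in> V1" "finite f" using E1[of f] x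
          by (auto simp: card_2_iff)
        then have "v \<in># vdeg N" using in_vdegI f by metis
        then have "v \<in># vdeg M" using MN by (simp add: fib_def)
        then show False using vdeg_E2[OF M] \<open>v \<in> V1\<close> disj by blast
      qed
    qed
  }
next
  fix q assume q: "q \<in> D 2"
  obtain A A' B B' where q': "q = (A, A', B, B')" by (metis prod_cases4)
  have "(A + B + xy (0 + 2), A' + B' + xy 0) \<in> fib EG" using G_fibI q q' by blast
  moreover have "quad False r1 r2 (A + B + xy (0 + 2)) (A' + B' + xy 0) = q"
    using q unfolding q' by (auto simp: quad_def D_def r_simps bridge_notin)
  ultimately show "\<exists>M N. (M, N) \<in> fib EG \<and> quad False r1 r2 M N = q" by blast
next
  fix A A' assume "(A, A') \<in> fib E1"
  then show "\<exists>M N. (M, N) \<in> fib EG \<and> r1 M = A \<and> r1 N = A' \<and> set_mset M \<subseteq> E1"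
    by (intro exI[of _ A] exI[of _ A']) (auto simp: fib_def r_simps)
next
  fix A A' assume "(A, A') \<in> fib E2"
  then show "\<exists>M N. (M, N) \<in> fib EG \<and> r2 M = A \<and> r2 N = A' \<and> set_mset M \<subseteq> E2"
    by (intro exI[of _ A] exI[of _ A']) (auto simp: fib_def r_simps)
qed (auto simp: r_simps)

section \<open>Generators of the bridged graph from a complete set\<close>

lemma complete_vdeg1:
  assumes "complete W" "set_mset A \<subseteq> E1" "set_mset A' \<subseteq> E1" "vdeg A = vdeg A'"
  shows "(A, A') \<in> gen E1 {(a, a'). (a, a', {#}, {#}) \<in> W}"
  using assms by (auto simp: complete_def fib_def)

lemma complete_vdeg2:
  assumes "complete W" "set_mset B \<subseteq> E2" "set_mset B' \<subseteq> E2" "vdeg B = vdeg B'"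
  shows "(B, B') \<in> gen E2 {(b, b'). ({#}, {#}, b, b') \<in> W}"
  using assms by (auto simp: complete_def fib_def)

text \<open>Cancelling \<open>c\<close> shows that \<open>a\<close> and \<open>a'\<close> differ in
  degree, so the quadruple supplied by completeness cannot be of level 0.\<close>

lemma complete_crossing:
  assumes "complete W" "W \<subseteq> D 0 \<union> D 2" "(A, A', B, B') \<in> D 2"
  obtains a a' b b' c d where "(a, a', b, b') \<in> W" "(a, a', b, b') \<in> D 2"
    "set_mset c \<subseteq> E1" "set_mset d \<subseteq> E2"
    "vdeg (a + c) = vdeg A" "vdeg (a' + c) = vdeg A'" "vdeg (b + d) = vdeg B" "vdeg (b' + d) = vdeg B'"
proof -
  obtain a a' b b' c d where *: "(a, a', b, b') \<in> W"
    "set_mset c \<subseteq> E1" "set_mset d \<subseteq> E2"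
    "vdeg (a + c) = vdeg A" "vdeg (a' + c) = vdeg A'" "vdeg (b + d) = vdeg B" "vdeg (b' + d) = vdeg B'"
    using assms(1,3) unfolding complete_def by blast
  have "vdeg a' + vdeg c = vdeg a + replicate_mset 2 x + vdeg c"
    using *(4,5) assms(3) unfolding D_def vdeg_add by (simp add: ac_simps)
  then have "vdeg a' \<noteq> vdeg a" by (simp add: numeral_2_eq_2)
  then have "(a, a', b, b') \<notin> D 0" by (simp add: D_def)
  then show thesis using that * assms(2) by blast
qed

text \<open>On \<open>D n\<close> the difference of sizes equals \<open>n\<close>, so the exponent
  of the bridge is read off the quadruple itself.\<close>

definition mkG where
  "mkG = (\<lambda>(a, a', b, b'). (a + b + xy (size (vdeg a') - size (vdeg a)), a' + b'))"

text \<open>Only pairs in \<open>Q\<close> have to be connected. Level 0 is settled inside the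
  parts; at level 2 both ends are adjusted inside the parts to a multiple of one crossing
  generator.\<close>

lemma G_generators:
  assumes W: "complete W" "W \<subseteq> D 0 \<union> D 2"
  shows "mkG ` W \<subseteq> fib EG" "fib EG \<subseteq> gen EG (mkG ` W)"
proof -
  let ?P = "mkG ` W"
  interpret G: presentation V1 V2 E1 E2 x y y0 EG E1 E2 r1 r2 False by (rule G_presentation)
  have mk: "mkG (a, a', b, b') = (a + b + xy n, a' + b')" if "(a, a', b, b') \<in> D n" for a a' b b' n
    using that by (simp add: mkG_def D_def)
  have mkW: "(a + b + xy n, a' + b') \<in> ?P" if "(a, a', b, b') \<in> W" "(a, a', b, b') \<in> D n" for a a' b b' n
    using mk[OF that(2)] that(1) by (metis image_eqI)
  show "?P \<subseteq> fib EG"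
  proof
    fix p assume "p \<in> ?P"
    then obtain a a' b b' where p: "p = mkG (a, a', b, b')" "(a, a', b, b') \<in> W" by (metis imageE prod_cases4)
    then obtain n where "(a, a', b, b') \<in> D n" using W(2) by blast
    then show "p \<in> fib EG" using G_fibI[of a a' b b' n 0] mk p by simp
  qed
  have g1: "(A, A') \<in> gen EG ?P" if "set_mset A \<subseteq> E1" "set_mset A' \<subseteq> E1" "vdeg A = vdeg A'" for A A'
  proof (rule gen_hom[OF complete_vdeg1[OF W(1) that], where h = id, simplified])
    fix a a' assume a: "(a, a', {#}, {#}) \<in> W"
    then have "(a, a', {#}, {#}) \<in> D 0" using W(2) by (auto simp: D_def)
    then show "(a, a') \<in> ?P \<or> (a', a) \<in> ?P" using mkW[OF a] by force
  qed auto
  have g2: "(B, B') \<in> gen EG ?P" if "set_mset B \<subseteq> E2" "set_mset B' \<subseteq> E2" "vdeg B = vdeg B'" for B B'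
  proof (rule gen_hom[OF complete_vdeg2[OF W(1) that], where h = id, simplified])
    fix a a' assume a: "({#}, {#}, a, a') \<in> W"
    then have "({#}, {#}, a, a') \<in> D 0" using W(2) by (auto simp: D_def)
    then show "(a, a') \<in> ?P \<or> (a', a) \<in> ?P" using mkW[OF a] by force
  qed auto
  have g12: "(A + B + xy n, A' + B' + xy n) \<in> gen EG ?P"
    if "set_mset A \<subseteq> E1" "set_mset A' \<subseteq> E1" "vdeg A = vdeg A'"
       "set_mset B \<subseteq> E2" "set_mset B' \<subseteq> E2" "vdeg B = vdeg B'" for A A' B B' n
    using that by (intro gen_add2 g1 g2 gen_refl) (auto split: if_splits)
  have "G.Q \<subseteq> gen EG ?P"
  proof (rule subrelI)
    fix M N assume "(M, N) \<in> G.Q"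
    then have MN: "(M, N) \<in> fib EG" and "(r1 M, r1 N, r2 M, r2 N) \<in> D 0 \<union> D 2"
      unfolding G.Q_def quad_def by auto
    then obtain n where D: "(r1 M, r1 N, r2 M, r2 N) \<in> D n" and n: "n = 0 \<or> n = 2" by blast
    define l where "l = count N {x, y}"
    have M: "M = r1 M + r2 M + xy (l + n)" and N: "N = r1 N + r2 N + xy l"
      using G_decomp[of M] G_decomp[of N] MN G_level[OF MN D] by (simp_all add: fib_def l_def)
    have sub: "set_mset (r1 M) \<subseteq> E1" "set_mset (r1 N) \<subseteq> E1" "set_mset (r2 M) \<subseteq> E2" "set_mset (r2 N) \<subseteq> E2"
      by auto
    show "(M, N) \<in> gen EG ?P"
    proof (cases "n = 0")
      case True
      have "(r1 M + r2 M + xy l, r1 N + r2 N + xy l) \<in> gen EG ?P"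
        using D True by (intro g12 sub) (auto simp: D_def)
      then show ?thesis using M N True by simp
    next
      case False
      then have D2: "(r1 M, r1 N, r2 M, r2 N) \<in> D 2" using D n by auto
      obtain a a' b b' c d where c: "(a, a', b, b') \<in> W" "(a, a', b, b') \<in> D 2"
        "set_mset c \<subseteq> E1" "set_mset d \<subseteq> E2"
        "vdeg (a + c) = vdeg (r1 M)" "vdeg (a' + c) = vdeg (r1 N)"
        "vdeg (b + d) = vdeg (r2 M)" "vdeg (b' + d) = vdeg (r2 N)"
        by (rule complete_crossing[OF W D2])
      have abs: "set_mset (a + c) \<subseteq> E1" "set_mset (a' + c) \<subseteq> E1" "set_mset (b + d) \<subseteq> E2" "set_mset (b' + d) \<subseteq> E2"
        using c(2-4) by (auto simp: D_def)
      have 1: "(r1 M + r2 M + xy (l + 2), (a + c) + (b + d) + xy (l + 2)) \<in> gen EG ?P"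
        using c by (intro g12 sub abs) auto
      \<comment> \<open>The common factor of the crossing also carries the \<open>l\<close> bridges
        present on both sides.\<close>
      have "(c + d + xy l + (a + b + xy 2), c + d + xy l + (a' + b')) \<in> gen EG ?P"
        by (rule gen_base[OF mkW[OF c(1,2)]]) (use c in \<open>auto split: if_splits\<close>)
      moreover have "xy (l + 2) = xy l + xy 2" by (auto simp: multiset_eq_iff)
      ultimately have 2: "((a + c) + (b + d) + xy (l + 2), (a' + c) + (b' + d) + xy l) \<in> gen EG ?P"
        by (simp only: ac_simps)
      have 3: "((a' + c) + (b' + d) + xy l, r1 N + r2 N + xy l) \<in> gen EG ?P"
        using c by (intro g12 sub abs) auto
      have "n = 2" using n False by simp
      then show ?thesis using gen_trans[OF gen_trans[OF 1 2] 3] M N by simp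
    qed
  qed
  then show "fib EG \<subseteq> gen EG ?P"
    using G.fib_subset_closure equiv_closure_subset_gen by blast
qed

section \<open>The contracted graph\<close>

abbreviation "chi \<equiv> contr_map x y y0"
abbreviation "ch \<equiv> (\<lambda>f. contr_map x y y0 ` f)"
abbreviation "EC \<equiv> contract_E EG x y y0"
text \<open>Contraction is injective on \<open>E1 \<union> E2\<close>, so monomials of the
  contracted graph lift uniquely and can be split into the two parts.\<close>

abbreviation "lift N \<equiv> image_mset (inv_into (E1 \<union> E2) ch) N"
abbreviation "c1 N \<equiv> r1 (lift N)"
abbreviation "c2 N \<equiv> r2 (lift N)"

lemma EC_eq: "EC = ch ` (E1 \<union> E2)"
  using bridge_notin by (auto simp: contract_E_def)

lemma image_ch_subset: "set_mset A \<subseteq> E1 \<union> E2 \<Longrightarrow> set_mset (image_mset ch A) \<subseteq> EC"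
  unfolding EC_eq by auto

lemma inj_chi: "inj_on chi V1" "inj_on chi V2"
  using y0 x y disj by (auto simp: inj_on_def contr_map_def)

lemma inj_chi_edge: "f \<in> E1 \<union> E2 \<Longrightarrow> inj_on chi f"
  using E1[of f] E2[of f] inj_chi inj_on_subset by blast

lemma EC_card2: "\<forall>f\<in>EC. card f = 2"
  unfolding EC_eq using card_image[OF inj_chi_edge] edges_card2 by auto

text \<open>An edge of the first part has an endpoint other than \<open>x\<close>; contraction fixes
  it, and no contracted edge of the second part contains it.\<close>

lemma ch_E1_E2: assumes "f \<in> E1" "g \<in> E2" shows "ch f \<noteq> ch g"
proof
  assume eq: "ch f = ch g"
  have f: "f \<subseteq> V1" "card f = 2" "g \<subseteq> V2" using E1 E2 assms by auto
  then have "f \<noteq> {}" "f \<noteq> {x}" by auto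
  then obtain u where u: "u \<in> f" "u \<noteq> x" by blast
  then have "u \<in> ch f" using f y disj by (force simp: contr_map_def)
  then have "u \<in> ch g" using eq by simp
  then have "u \<in> V2 \<or> u = y0" using f by (auto simp: contr_map_def split: if_splits)
  then show False using u f y0 disj by auto
qed

lemma inj_ch: "inj_on ch (E1 \<union> E2)"
proof (rule inj_onI)
  fix f g assume fg: "f \<in> E1 \<union> E2" "g \<in> E1 \<union> E2" and eq: "ch f = ch g"
  then consider "f \<in> E1" "g \<in> E1" | "f \<in> E2" "g \<in> E2" using ch_E1_E2[of f g] ch_E1_E2[of g f] by auto
  then show "f = g"
  proof cases
    case 1 then show ?thesis using inj_on_image_eq_iff[OF inj_chi(1)] E1 eq by metis
  next
    case 2 then show ?thesis using inj_on_image_eq_iff[OF inj_chi(2)] E2 eq by metis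
  qed
qed

lemma lift_ch: assumes "set_mset A \<subseteq> E1 \<union> E2" shows "lift (image_mset ch A) = A"
proof -
  have "image_mset (\<lambda>f. inv_into (E1 \<union> E2) ch (ch f)) A = image_mset id A"
    using assms inv_into_f_f[OF inj_ch] by (intro image_mset_cong) auto
  then show ?thesis by (simp add: multiset.map_comp comp_def)
qed

lemma c_add:
  assumes "set_mset A \<subseteq> E1" "set_mset B \<subseteq> E2"
  shows "c1 (image_mset ch (A + B)) = A" "c2 (image_mset ch (A + B)) = B"
proof -
  have "set_mset (A + B) \<subseteq> E1 \<union> E2" using assms by auto
  then show "c1 (image_mset ch (A + B)) = A" "c2 (image_mset ch (A + B)) = B"
    using assms by (simp_all only: lift_ch) (simp_all add: r_simps)
qed

lemma C_decomp: assumes "set_mset N \<subseteq> EC" shows "N = image_mset ch (c1 N + c2 N)"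
proof -
  have sub: "set_mset (lift N) \<subseteq> E1 \<union> E2"
    using assms inv_into_into[of _ ch "E1 \<union> E2"] unfolding EC_eq by auto
  have "c1 N + c2 N = lift N" by (rule E12_decomp[OF sub])
  moreover have "image_mset ch (lift N) = image_mset id N"
    unfolding multiset.map_comp comp_def id_def
    by (rule image_mset_cong, rule f_inv_into_f) (use assms EC_eq in blast)
  ultimately show ?thesis by simp
qed

lemma vdeg_ch: "set_mset A \<subseteq> E1 \<union> E2 \<Longrightarrow> vdeg (image_mset ch A) = image_mset chi (vdeg A)"
  by (induction A) (auto simp: image_mset_mset_set inj_chi_edge)

lemma chi_xy: "chi x = y0" "chi y = y0"
  by (simp_all add: contr_map_def)

lemma count_chi:
  assumes "set_mset X \<subseteq> V1 \<union> V2"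
  shows "count (image_mset chi X) v =
    (if v = y0 then count X x + count X y else if v = x \<or> v = y then 0 else count X v)"
  using assms y0 x y x_neq_y by (induction X) (auto simp: contr_map_def)

text \<open>The order of the last two entries is the twist: \<open>x\<close> and \<open>y\<close>
  have the same image, so the \<open>n\<close> copies of \<open>x\<close> gained by
  \<open>A'\<close> balance the \<open>n\<close> copies of \<open>y\<close> lost by
  \<open>B'\<close>.\<close>

lemma C_fibI:
  assumes "(A, A', B', B) \<in> D n"
  shows "(image_mset ch (A + B), image_mset ch (A' + B')) \<in> fib EC"
proof -
  have sub: "set_mset (A + B) \<subseteq> E1 \<union> E2" "set_mset (A' + B') \<subseteq> E1 \<union> E2" using assms by (auto simp: D_def)
  have "vdeg A' = vdeg A + replicate_mset n x" "vdeg B = vdeg B' + replicate_mset n y"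
    using assms by (auto simp: D_def)
  then have "image_mset chi (vdeg (A + B)) = image_mset chi (vdeg (A' + B'))"
    by (simp add: chi_xy)
  then show ?thesis using vdeg_ch[OF sub(1)] vdeg_ch[OF sub(2)] image_ch_subset[OF sub(1)] image_ch_subset[OF sub(2)]
    unfolding fib_def by simp
qed

text \<open>Equality of degrees fixes every vertex count except those at \<open>x\<close> and
  \<open>y\<close>, of which the merged vertex sees only the sum. What the first part gains at
  \<open>x\<close> is therefore what the second loses at \<open>y\<close>.\<close>

lemma C_fibD:
  assumes "(M, N) \<in> fib EC"
  shows "\<exists>n. (c1 M, c1 N, c2 N, c2 M) \<in> D n \<or> (c1 N, c1 M, c2 M, c2 N) \<in> D n"
proof -
  have sub: "set_mset (c1 K) \<subseteq> E1" "set_mset (c2 K) \<subseteq> E2" for K by auto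
  have V: "set_mset (vdeg (c1 K)) \<subseteq> V1" "set_mset (vdeg (c2 K)) \<subseteq> V2" for K
    using vdeg_E1[OF sub(1)] vdeg_E2[OF sub(2)] .
  have zero: "v \<notin> V1 \<Longrightarrow> count (vdeg (c1 K)) v = 0" "v \<notin> V2 \<Longrightarrow> count (vdeg (c2 K)) v = 0" for K v
    using V[of K] by (meson count_eq_zero_iff subsetD)+
  have eq: "vdeg K = image_mset chi (vdeg (c1 K + c2 K))" if "set_mset K \<subseteq> EC" for K
  proof -
    have "set_mset (c1 K + c2 K) \<subseteq> E1 \<union> E2" by auto
    then show ?thesis using vdeg_ch C_decomp[OF that] by metis
  qed
  have im: "image_mset chi (vdeg (c1 M + c2 M)) = image_mset chi (vdeg (c1 N + c2 N))"
    using eq[of M] eq[of N] assms by (simp only: fib_def) auto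
  have VV: "set_mset (vdeg (c1 K + c2 K)) \<subseteq> V1 \<union> V2" for K
    using V[of K] by (simp only: vdeg_add set_mset_union) blast
  have cnt: "(if v = y0 then count (vdeg (c1 M + c2 M)) x + count (vdeg (c1 M + c2 M)) y
      else if v = x \<or> v = y then 0 else count (vdeg (c1 M + c2 M)) v) =
    (if v = y0 then count (vdeg (c1 N + c2 N)) x + count (vdeg (c1 N + c2 N)) y
      else if v = x \<or> v = y then 0 else count (vdeg (c1 N + c2 N)) v)" for v
    using arg_cong[OF im, of "\<lambda>X. count X v"] unfolding count_chi[OF VV] .
  have xz: "x \<notin> V2" "y \<notin> V1" using x y disj by auto
  have tot: "count (vdeg (c1 M)) x + count (vdeg (c2 M)) y = count (vdeg (c1 N)) x + count (vdeg (c2 N)) y"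
    using cnt[of y0] zero(1)[OF xz(2)] zero(2)[OF xz(1)] by simp
  have v1: "count (vdeg (c1 M)) v = count (vdeg (c1 N)) v" if "v \<noteq> x" for v
  proof (cases "v \<in> V1")
    case True
    then have "v \<noteq> y0" "v \<noteq> y" "v \<notin> V2" using y0 xz disj by auto
    then show ?thesis using cnt[of v] that zero(2) by simp
  qed (simp add: zero)
  have v2: "count (vdeg (c2 M)) v = count (vdeg (c2 N)) v" if "v \<noteq> y" for v
  proof (cases "v \<in> V2")
    case True
    then have "v \<noteq> y0" "v \<noteq> x" "v \<notin> V1" using y0 xz disj by auto
    then show ?thesis using cnt[of v] that zero(1) by simp
  qed (simp add: zero)
  show ?thesis
  proof (cases "count (vdeg (c1 M)) x \<le> count (vdeg (c1 N)) x")
    case True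
    then have "(c1 M, c1 N, c2 N, c2 M) \<in> D (count (vdeg (c1 N)) x - count (vdeg (c1 M)) x)"
      using sub tot v1 v2 by (auto simp: D_def multiset_eq_iff)
    then show ?thesis by blast
  next
    case False
    then have "(c1 N, c1 M, c2 M, c2 N) \<in> D (count (vdeg (c1 M)) x - count (vdeg (c1 N)) x)"
      using sub tot v1 v2 by (auto simp: D_def multiset_eq_iff)
    then show ?thesis by blast
  qed
qed

text \<open>If a part is absent from one monomial, its degree in the other is concentrated at the
  contracted endpoint.\<close>

lemma differ_from_empty:
  "X = {#} \<Longrightarrow> X = Y + replicate_mset m v \<or> Y = X + replicate_mset m v \<Longrightarrow> set_mset Y \<subseteq> {v}"
  by (auto split: if_splits)

lemma C_presentation: "presentation V1 V2 E1 E2 x y y0 EC (ch ` E1) (ch ` E2) c1 c2 True"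
proof unfold_locales
  show p1: "c2 M = {#}" if "set_mset M \<subseteq> ch ` E1" for M
    using image_mset_preimage[OF that] c_add(2)[of _ "{#}"] by auto
  show p2: "c1 M = {#}" if "set_mset M \<subseteq> ch ` E2" for M
    using image_mset_preimage[OF that] c_add(1)[of "{#}"] by auto
  fix M N assume MN: "(M, N) \<in> fib EC"
  then have sub: "set_mset M \<subseteq> EC" "set_mset N \<subseteq> EC" by (auto simp: fib_def)
  obtain m where m: "(c1 M, c1 N, c2 N, c2 M) \<in> D m \<or> (c1 N, c1 M, c2 M, c2 N) \<in> D m"
    using C_fibD[OF MN] by blast
  show "\<exists>n. quad True c1 c2 M N \<in> D n \<or> quad True c1 c2 N M \<in> D n"
    using C_fibD[OF MN] by (simp add: quad_def)
  {
    fix n assume "quad True c1 c2 M N \<in> D (2 * n + 2)"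
    then have D: "(c1 M, c1 N, c2 N, c2 M) \<in> D (2 * Suc n)" by (simp add: quad_def)
    \<comment> \<open>The first part must rise by 2 from \<open>c1 M\<close>, the second fall by 2
      from \<open>c2 M\<close>, that is, stand \<open>2 * n\<close> above \<open>c2 N\<close>. Two
      intermediate points are therefore taken, using only \<open>A1\<close> of one and only
      \<open>B1\<close> of the other.\<close>
    obtain A1 B0 where A1: "(c1 M, A1, c2 N, B0) \<in> D (2 * 1)" "(A1, c1 N, B0, c2 M) \<in> D (2 * (Suc n - 1))"
      by (rule D_intermediate[OF D, of 1]) auto
    obtain A0 B1 where B1: "(c1 M, A0, c2 N, B1) \<in> D (2 * n)" "(A0, c1 N, B1, c2 M) \<in> D (2 * (Suc n - n))"
      by (rule D_intermediate[OF D, of n]) auto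
    define L where "L = image_mset ch (A1 + B1)"
    have D1: "(c1 M, A1, B1, c2 M) \<in> D 2" and D2: "(A1, c1 N, c2 N, B1) \<in> D (2 * n)"
      using A1 B1 by (auto simp: D_def)
    have L: "c1 L = A1" "c2 L = B1" unfolding L_def using D1 by (intro c_add; auto simp: D_def)+
    have "(M, L) \<in> fib EC" unfolding L_def
      by (subst C_decomp[OF sub(1)]) (rule C_fibI[OF D1])
    then show "\<exists>L. (M, L) \<in> fib EC \<and> quad True c1 c2 M L \<in> D 2 \<and> quad True c1 c2 L N \<in> D (2 * n)"
      using D1 D2 L by (intro exI[of _ L]) (simp add: quad_def)
  }
  {
    assume "set_mset M \<subseteq> ch ` E1"
    then have "c2 M = {#}" by (rule p1)
    then have "vdeg (c2 M) = {#}" by (simp only: vdeg_empty)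
    then have "set_mset (vdeg (c2 N)) \<subseteq> {y}"
      by (rule differ_from_empty) (use m in \<open>unfold D_def, blast\<close>)
    then have "c2 N = {#}" by (intro edges_at_single_vertex) auto
    then have "N = image_mset ch (c1 N)" using C_decomp[OF sub(2)] by (metis add.right_neutral)
    moreover have "set_mset (image_mset ch (c1 N)) \<subseteq> ch ` E1" by auto
    ultimately show "set_mset N \<subseteq> ch ` E1" by metis
  }
  {
    assume "set_mset M \<subseteq> ch ` E2"
    then have "c1 M = {#}" by (rule p2)
    then have "vdeg (c1 M) = {#}" by (simp only: vdeg_empty)
    then have "set_mset (vdeg (c1 N)) \<subseteq> {x}"
      by (rule differ_from_empty) (use m in \<open>unfold D_def, blast\<close>)
    then have "c1 N = {#}" by (intro edges_at_single_vertex) auto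
    then have "N = image_mset ch (c2 N)" using C_decomp[OF sub(2)] by (metis add.left_neutral)
    moreover have "set_mset (image_mset ch (c2 N)) \<subseteq> ch ` E2" by auto
    ultimately show "set_mset N \<subseteq> ch ` E2" by metis
  }
next
  fix q assume q: "q \<in> D 2"
  obtain A A' B' B where q': "q = (A, A', B', B)" by (metis prod_cases4)
  have "(image_mset ch (A + B), image_mset ch (A' + B')) \<in> fib EC" using C_fibI q q' by blast
  moreover have "quad True c1 c2 (image_mset ch (A + B)) (image_mset ch (A' + B')) = q"
    using q unfolding q' by (simp add: quad_def D_def c_add del: image_mset_union)
  ultimately show "\<exists>M N. (M, N) \<in> fib EC \<and> quad True c1 c2 M N = q" by blast
next
  fix A A' assume A: "(A, A') \<in> fib E1"
  then have "(A, A', {#}, {#}) \<in> D 0" by (auto simp: fib_def D_def)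
  from C_fibI[OF this] have "(image_mset ch A, image_mset ch A') \<in> fib EC" by simp
  moreover have "c1 (image_mset ch A) = A" "c1 (image_mset ch A') = A'" "set_mset (image_mset ch A) \<subseteq> ch ` E1"
    using A c_add(1)[of A "{#}"] c_add(1)[of A' "{#}"] by (auto simp: fib_def)
  ultimately show "\<exists>M N. (M, N) \<in> fib EC \<and> c1 M = A \<and> c1 N = A' \<and> set_mset M \<subseteq> ch ` E1" by blast
next
  fix B B' assume B: "(B, B') \<in> fib E2"
  then have "({#}, {#}, B', B) \<in> D 0" by (auto simp: fib_def D_def)
  from C_fibI[OF this] have "(image_mset ch B, image_mset ch B') \<in> fib EC" by simp
  moreover have "c2 (image_mset ch B) = B" "c2 (image_mset ch B') = B'" "set_mset (image_mset ch B) \<subseteq> ch ` E2"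
    using B c_add(2)[of "{#}" B] c_add(2)[of "{#}" B'] by (auto simp: fib_def)
  ultimately show "\<exists>M N. (M, N) \<in> fib EC \<and> c2 M = B \<and> c2 N = B' \<and> set_mset M \<subseteq> ch ` E2" by blast
qed auto

definition mkC where
  "mkC = (\<lambda>(a, a', b, b'). (image_mset ch (a + b'), image_mset ch (a' + b)))"

lemma C_generators:
  assumes W: "complete W" "W \<subseteq> D 0 \<union> D 2"
  shows "mkC ` W \<subseteq> fib EC" "fib EC \<subseteq> gen EC (mkC ` W)"
proof -
  let ?P = "mkC ` W"
  interpret C: presentation V1 V2 E1 E2 x y y0 EC "ch ` E1" "ch ` E2" c1 c2 True by (rule C_presentation)
  show "?P \<subseteq> fib EC"
  proof
    fix p assume "p \<in> ?P"
    then obtain a a' b b' where p: "p = mkC (a, a', b, b')" "(a, a', b, b') \<in> W" by (metis imageE prod_cases4)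
    then obtain n where "(a, a', b, b') \<in> D n" using W(2) by blast
    then show "p \<in> fib EC" using C_fibI[of a a' b b' n] p(1) by (simp add: mkC_def)
  qed
  have mkW: "(image_mset ch (a + b'), image_mset ch (a' + b)) \<in> ?P" if "(a, a', b, b') \<in> W" for a a' b b'
    using imageI[OF that, of mkC] by (simp add: mkC_def)
  note subC = image_ch_subset
  have g1: "(image_mset ch A, image_mset ch A') \<in> gen EC ?P"
    if "set_mset A \<subseteq> E1" "set_mset A' \<subseteq> E1" "vdeg A = vdeg A'" for A A'
  proof (rule gen_hom[OF complete_vdeg1[OF W(1) that], where h = "image_mset ch"])
    fix a a' assume "(a, a') \<in> {(a, a'). (a, a', {#}, {#}) \<in> W}"
    then show "(image_mset ch a, image_mset ch a') \<in> ?P \<union> ?P\<inverse>" using mkW[of a a' "{#}" "{#}"] by simp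
  qed (simp, rule subC, blast)
  have g2: "(image_mset ch B, image_mset ch B') \<in> gen EC ?P"
    if "set_mset B \<subseteq> E2" "set_mset B' \<subseteq> E2" "vdeg B = vdeg B'" for B B'
  proof (rule gen_hom[OF complete_vdeg2[OF W(1) that], where h = "image_mset ch"])
    fix b b' assume "(b, b') \<in> {(b, b'). ({#}, {#}, b, b') \<in> W}"
    then show "(image_mset ch b, image_mset ch b') \<in> ?P \<union> ?P\<inverse>" using mkW[of "{#}" "{#}" b b'] by simp
  qed (simp, rule subC, blast)
  have g12: "(image_mset ch (A + B), image_mset ch (A' + B')) \<in> gen EC ?P"
    if "set_mset A \<subseteq> E1" "set_mset A' \<subseteq> E1" "vdeg A = vdeg A'"
       "set_mset B \<subseteq> E2" "set_mset B' \<subseteq> E2" "vdeg B = vdeg B'" for A A' B B'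
    unfolding image_mset_union using that by (intro gen_add2 g1 g2 subC) auto
  have "C.Q \<subseteq> gen EC ?P"
  proof (rule subrelI)
    fix M N assume "(M, N) \<in> C.Q"
    then have MN: "(M, N) \<in> fib EC" and D: "(c1 M, c1 N, c2 N, c2 M) \<in> D 0 \<union> D 2"
      unfolding C.Q_def quad_def by auto
    have M: "M = image_mset ch (c1 M + c2 M)" and N: "N = image_mset ch (c1 N + c2 N)"
      using MN by (intro C_decomp; simp add: fib_def)+
    have sub: "set_mset (c1 K) \<subseteq> E1" "set_mset (c2 K) \<subseteq> E2" for K by auto
    have "(image_mset ch (c1 M + c2 M), image_mset ch (c1 N + c2 N)) \<in> gen EC ?P"
    proof (cases "(c1 M, c1 N, c2 N, c2 M) \<in> D 0")
      case True
      then show ?thesis by (intro g12 sub) (auto simp: D_def)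
    next
      case False
      then have D2: "(c1 M, c1 N, c2 N, c2 M) \<in> D 2" using D by auto
      obtain a a' b b' c d where c: "(a, a', b, b') \<in> W" "(a, a', b, b') \<in> D 2"
        "set_mset c \<subseteq> E1" "set_mset d \<subseteq> E2"
        "vdeg (a + c) = vdeg (c1 M)" "vdeg (a' + c) = vdeg (c1 N)"
        "vdeg (b + d) = vdeg (c2 N)" "vdeg (b' + d) = vdeg (c2 M)"
        by (rule complete_crossing[OF W D2])
      have abs: "set_mset (a + c) \<subseteq> E1" "set_mset (a' + c) \<subseteq> E1" "set_mset (b + d) \<subseteq> E2" "set_mset (b' + d) \<subseteq> E2"
        using c(2-4) by (auto simp: D_def)
      have 1: "(image_mset ch (c1 M + c2 M), image_mset ch ((a + c) + (b' + d))) \<in> gen EC ?P"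
        by (rule g12[OF sub(1) abs(1) c(5)[symmetric] sub(2) abs(4) c(8)[symmetric]])
      \<comment> \<open>The crossing generator is multiplied by the contracted cofactors of both
        parts.\<close>
      have "(image_mset ch (c + d) + image_mset ch (a + b'), image_mset ch (c + d) + image_mset ch (a' + b)) \<in> gen EC ?P"
        by (rule gen_base[OF mkW[OF c(1)] subC]) (use c in auto)
      then have 2: "(image_mset ch ((a + c) + (b' + d)), image_mset ch ((a' + c) + (b + d))) \<in> gen EC ?P"
        by (simp add: ac_simps)
      have 3: "(image_mset ch ((a' + c) + (b + d)), image_mset ch (c1 N + c2 N)) \<in> gen EC ?P"
        by (rule g12[OF abs(2) sub(1) c(6) abs(3) sub(2) c(7)])
      show ?thesis by (rule gen_trans[OF gen_trans[OF 1 2] 3])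
    qed
    then show "(M, N) \<in> gen EC ?P" using M N by metis
  qed
  then show "fib EC \<subseteq> gen EC ?P"
    using C.fib_subset_closure equiv_closure_subset_gen by blast
qed

end

text \<open>When \<open>p\<close> has no witness, neither has \<open>q\<close>; both predicates are
  then constantly false and \<open>Least\<close> agrees on them.\<close>

lemma Least_eqI_le:
  fixes p q :: "nat \<Rightarrow> bool"
  assumes "\<And>n. p n \<Longrightarrow> \<exists>m\<le>n. q m" "\<And>n. q n \<Longrightarrow> \<exists>m\<le>n. p m"
  shows "Least p = Least q"
proof (cases "\<exists>n. p n")
  case True
  then have p: "p (Least p)" by (metis LeastI)
  then have q: "q (Least q)" using assms(1) by (metis LeastI)
  show ?thesis using assms(1)[OF p] assms(2)[OF q] by (meson Least_le antisym le_trans)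
next
  case False
  then have "p = q" using assms(2) by blast
  then show ?thesis by simp
qed

theorem theorem4p2:
  fixes V1 V2 :: "'v set" and E1 E2 :: "'v set set" and x y y0 :: 'v
  assumes "simple_graph V1 E1" and "connected_graph V1 E1"
    and "simple_graph V2 E2" and "connected_graph V2 E2"
    and "V1 \<inter> V2 = {}"
    and "x \<in> V1" and "y \<in> V2"
    and "y0 \<notin> V1 \<union> V2"
  shows "beta1 TYPE('k::field) (E1 \<union> E2 \<union> {{x, y}})
       = beta1 TYPE('k) (contract_E (E1 \<union> E2 \<union> {{x, y}}) x y y0)"
proof -
  interpret bridge V1 V2 E1 E2 x y y0
    using assms by unfold_locales (auto simp: simple_graph_def)
  interpret G: presentation V1 V2 E1 E2 x y y0 EG E1 E2 r1 r2 False by (rule G_presentation)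
  interpret C: presentation V1 V2 E1 E2 x y y0 EC "ch ` E1" "ch ` E2" c1 c2 True by (rule C_presentation)
  show ?thesis unfolding beta1_def
  proof (rule Least_eqI_le)
    fix n assume "\<exists>S :: ('v, 'k) epoly set. finite S \<and> card S = n \<and> S \<subseteq> toric_ideal EG \<and> ideal_span EG S = toric_ideal EG"
    then obtain S :: "('v, 'k) epoly set" where S: "finite S" "card S = n" "S \<subseteq> toric_ideal EG" "ideal_span EG S = toric_ideal EG"
      by blast
    \<comment> \<open>\<open>W\<close> is the common currency of the two ideals: cardinalities can
      only drop from \<open>S\<close> to \<open>W\<close> and from \<open>W\<close> to
      \<open>T\<close>.\<close>
    obtain W where W: "finite W" "card W \<le> n" "W \<subseteq> D 0 \<union> D 2" "complete W"
      using G.complete_of_toric_generators[OF EG_card2 S(1,3,4)] S(2) by blast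
    obtain T :: "('v, 'k) epoly set" where "finite T" "card T \<le> card (mkC ` W)"
      "T \<subseteq> toric_ideal EC" "ideal_span EC T = toric_ideal EC"
      by (rule gen_imp_toric_generators[OF C_generators(1)[OF W(4,3)] _ C_generators(2)[OF W(4,3)]])
        (use W(1) in auto)
    moreover have "card (mkC ` W) \<le> n" using card_image_le[OF W(1), of mkC] W(2) by simp
    ultimately show "\<exists>m\<le>n. \<exists>S :: ('v, 'k) epoly set. finite S \<and> card S = m \<and> S \<subseteq> toric_ideal EC \<and> ideal_span EC S = toric_ideal EC"
      by (intro exI[of _ "card T"] conjI exI[of _ T]) simp_all
  next
    fix n assume "\<exists>S :: ('v, 'k) epoly set. finite S \<and> card S = n \<and> S \<subseteq> toric_ideal EC \<and> ideal_span EC S = toric_ideal EC"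
    then obtain S :: "('v, 'k) epoly set" where S: "finite S" "card S = n" "S \<subseteq> toric_ideal EC" "ideal_span EC S = toric_ideal EC"
      by blast
    obtain W where W: "finite W" "card W \<le> n" "W \<subseteq> D 0 \<union> D 2" "complete W"
      using C.complete_of_toric_generators[OF EC_card2 S(1,3,4)] S(2) by blast
    obtain T :: "('v, 'k) epoly set" where "finite T" "card T \<le> card (mkG ` W)"
      "T \<subseteq> toric_ideal EG" "ideal_span EG T = toric_ideal EG"
      by (rule gen_imp_toric_generators[OF G_generators(1)[OF W(4,3)] _ G_generators(2)[OF W(4,3)]])
        (use W(1) in auto)
    moreover have "card (mkG ` W) \<le> n" using card_image_le[OF W(1), of mkG] W(2) by simp
    ultimately show "\<exists>m\<le>n. \<exists>S :: ('v, 'k) epoly set. finite S \<and> card S = m \<and> S \<subseteq> toric_ideal EG \<and> ideal_span EG S = toric_ideal EG"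
      by (intro exI[of _ "card T"] conjI exI[of _ T]) simp_all
  qed
qed

end
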